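(* Let $G_0$ be a known distribution function of a non-negative random variable with finite positive mean, and let $X_1,X_2,\ldots$ be independent non-negative random variables with common distribution function $F$, where $F$ has a density and finite positive mean $\mu_F$. Let $\delta_F$, $\delta_{G_0}$, $\delta(F,G_0)=\delta_F-\delta_{G_0}$ and, for $n\ge 2$, $\hat\delta(F,G_0)=\hat\delta_F-\delta_{G_0}$ be as defined in the context. Suppose $$E\Big[\max\{X_1,X_2\}-\tfrac{\delta_F}{2}(X_1+X_2)\Big]^2<\infty .$$ Then, as $n\to\infty$, $n^{1/2}[\hat\delta(F,G_0)-\delta(F,G_0)]$ is asymptotically normal (converges in distribution to a normal law) with mean $0$ and variance $$\sigma_F^2=\frac{4}{\mu_F^2}\,\mathrm{Var}\left(XF(X)+\int_{X}^{\infty}t\,dF(t)-\frac{\delta_F}{2}X\right),$$ where $X$ has distribution function $F$. Moreover, under $H_0: F=_*G_0$, $n^{1/2}\hat\delta(F,G_0)$ is asymptotically normal with mean $0$ and variance $\sigma_0^2=\sigma^2_{G_0}$, where $\sigma^2_{G_0}$ is given by the same formula with $F$ replaced by $G_0$ throughout (and $X$ having distribution function $G_0$).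
   Context: For a distribution function $H$ of a non-negative random variable with finite positive mean $\mu_H$, set $\mu_H^{(2)}=E[\max\{Z_1,Z_2\}]$ with $Z_1,Z_2$ independent with distribution function $H$, and $\delta_H=\mu_H^{(2)}/\mu_H$. The estimator of $\delta_F$ based on the sample $X_1,\ldots,X_n$ is $$\hat\delta_F=\frac{\sum\sum_{i\ne j}\max\{X_i,X_j\}}{n(n-1)\bar X},\qquad \bar X=\frac1n\sum_{i=1}^n X_i,$$ where the double sum is over all ordered pairs $(i,j)$ with $1\le i,j\le n$, $i\neq j$. Star order: $F\le_* G$ means that $G^{-1}(F(x))/x$ is nondecreasing in $x>0$, where $G^{-1}(u)=\sup\{x:G(x)\le u\}$ is the right-continuous inverse of $G$. The notation $F=_*G$ means $F\le_*G$ and $G\le_*F$, in which case $F(x)=G(ax)$ for all $x\ge 0$ and some $a>0$. *)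

theory Defs
  imports "HOL-Probability.Probability"
begin

definition nonneg_dist_fun :: "(real \<Rightarrow> real) \<Rightarrow> bool" where
  "nonneg_dist_fun H \<longleftrightarrow>
     (\<exists>N. real_distribution N \<and> (AE z in N. 0 \<le> z) \<and> cdf N = H)"

definition mean_df :: "(real \<Rightarrow> real) \<Rightarrow> real" where
  "mean_df H = (\<integral>z. z \<partial>interval_measure H)"

(* The integrability conjunct is essential: the integral of a non-integrable function is 0. *)
definition finite_pos_mean :: "(real \<Rightarrow> real) \<Rightarrow> bool" where
  "finite_pos_mean H \<longleftrightarrow> integrable (interval_measure H) (\<lambda>z. z) \<and> 0 < mean_df H"

definition has_density :: "(real \<Rightarrow> real) \<Rightarrow> bool" where
  "has_density H \<longleftrightarrow>
     (\<exists>f :: real \<Rightarrow> ennreal. f \<in> borel_measurable borel \<and> interval_measure H = density lborel f)"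

(* The product measure is the joint law of two independent variables with distribution function H. *)
definition mean_max_df :: "(real \<Rightarrow> real) \<Rightarrow> real" where
  "mean_max_df H =
     (\<integral>z. max (fst z) (snd z) \<partial>(interval_measure H \<Otimes>\<^sub>M interval_measure H))"

definition delta_df :: "(real \<Rightarrow> real) \<Rightarrow> real" where
  "delta_df H = mean_max_df H / mean_df H"

definition delta_diff :: "(real \<Rightarrow> real) \<Rightarrow> (real \<Rightarrow> real) \<Rightarrow> real" where
  "delta_diff F G = delta_df F - delta_df G"

definition sample_mean :: "nat \<Rightarrow> (nat \<Rightarrow> real) \<Rightarrow> real" where
  "sample_mean n x = 1 / real n * (\<Sum>i = 1..n. x i)"

definition delta_hat :: "nat \<Rightarrow> (nat \<Rightarrow> real) \<Rightarrow> real" where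
  "delta_hat n x =
     (\<Sum>i = 1..n. \<Sum>j \<in> {1..n} - {i}. max (x i) (x j))
       / (real n * (real n - 1) * sample_mean n x)"

definition delta_hat_diff :: "(real \<Rightarrow> real) \<Rightarrow> nat \<Rightarrow> (nat \<Rightarrow> real) \<Rightarrow> real" where
  "delta_hat_diff G n x = delta_hat n x - delta_df G"

(* Extended-real valued, so that the inverse at u = 1 is infinity (the set is then unbounded)
   instead of an unspecified real supremum. *)
definition right_inv_df :: "(real \<Rightarrow> real) \<Rightarrow> real \<Rightarrow> ereal" where
  "right_inv_df G u = Sup (ereal ` {x. G x \<le> u})"

definition star_le :: "(real \<Rightarrow> real) \<Rightarrow> (real \<Rightarrow> real) \<Rightarrow> bool" (infix "\<le>\<^sub>*" 50) where
  "F \<le>\<^sub>* G \<longleftrightarrow> mono_on {0<..} (\<lambda>x. right_inv_df G (F x) / ereal x)"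

definition star_eq :: "(real \<Rightarrow> real) \<Rightarrow> (real \<Rightarrow> real) \<Rightarrow> bool" (infix "=\<^sub>*" 50) where
  "F =\<^sub>* G \<longleftrightarrow> F \<le>\<^sub>* G \<and> G \<le>\<^sub>* F"

definition asym_var :: "(real \<Rightarrow> real) \<Rightarrow> real" where
  "asym_var H =
     4 / (mean_df H)\<^sup>2 *
       prob_space.variance (interval_measure H)
         (\<lambda>x. x * H x + (LINT t:{x<..}|interval_measure H. t) - delta_df H / 2 * x)"

(* normal_density takes the standard deviation, not the variance.  For v = 0 this is the null
   measure, so weak convergence of probability laws to it entails a nondegenerate limit. *)
definition normal_law :: "real \<Rightarrow> real \<Rightarrow> real measure" where
  "normal_law m v = density lborel (normal_density m (sqrt v))"

end

theory Submission
  imports Defs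
begin

text \<open>
  Write \<open>P\<close> for the law with distribution function \<open>F\<close>, \<open>\<mu>\<close> for its mean, \<open>d = \<delta>\<^sub>F / 2\<close>, and
  \<open>\<phi>(x, y) = max x y - d (x + y)\<close>.  The normalised double sum of \<open>\<phi>(X\<^sub>i, X\<^sub>j)\<close> is a U-statistic
  \<open>U\<^sub>n\<close> with mean zero, and the estimation error is exactly \<open>U\<^sub>n\<close> divided by the sample mean.
  So the theorem is the central limit theorem for U-statistics combined with the law of large
  numbers in the denominator.

  Moments.  Observations are nonnegative and \<open>P\<close> has a density, so \<open>P\<close> charges only positive numbers, hence
  \<open>max x y < x + y\<close> almost surely and \<open>d < 1\<close>.  Then \<open>\<phi>(x, y)\<close> grows like \<open>(1 - d) y\<close> for large \<open>y\<close>,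
  and square integrability of \<open>\<phi>(X\<^sub>1, X\<^sub>2)\<close> forces \<open>X\<^sub>1\<close> itself to have a second moment
  (\<open>square_integrable_from_kernel\<close>).  From there on everything takes place in \<open>L\<^sup>2\<close>.

  Linearization.  With \<open>h(x) = E \<phi>(x, X)\<close>, the kernel \<open>g(x, y) = \<phi>(x, y) - h(x) - h(y)\<close>
  vanishes when one argument is integrated out (the Hoeffding decomposition).  Its values on distinct
  unordered index pairs are therefore orthogonal, so the sum of the \<open>g(X\<^sub>i, X\<^sub>j)\<close> has second moment of order
  \<open>n\<^sup>2\<close> only (\<open>degenerate_U_statistic_second_moment\<close>).  After multiplication by \<open>sqrt n\<close> what
  survives is \<open>2 / (\<mu> sqrt n)\<close> times the sum of the \<open>h(X\<^sub>i)\<close>; the difference tends to zero in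
  probability at rate \<open>1 / sqrt n\<close> (\<open>delta_hat_linearization_bound\<close>) and the classical central
  limit theorem applies to the main term.

  Nondegeneracy.  A weak limit with a density requires \<open>Var (h(X)) > 0\<close>.  Up to a constant, \<open>h\<close> is
  \<open>x \<mapsto> E (max x X) - d x\<close>, a convex function; if it took the same value at three points, \<open>P\<close> would
  not charge the interval between the outer two.  For an atomless law this cannot happen almost
  everywhere (\<open>integral_max_not_affine\<close>).

  Null hypothesis.  If \<open>F\<close> and \<open>G\<close> are star equivalent and \<open>F\<close> is continuous, then \<open>F(x) = G(a x)\<close>
  for some \<open>a > 0\<close> (\<open>star_eq_imp_scale_family\<close>).  Both \<open>\<delta>\<close> and the asymptotic variance are scale
  invariant, which turns the first limit into the second.
\<close>

section \<open>Weak convergence\<close>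

text \<open>
  A form of Slutsky's theorem.  Because \<open>t \<mapsto> exp (i t)\<close> is Lipschitz and bounded, closeness in
  probability makes the characteristic functions close, and Levy's continuity theorem translates
  this back to weak convergence.
\<close>

lemma (in prob_space) weak_conv_m_of_difference_to_zero:
  fixes X Y :: "nat \<Rightarrow> 'a \<Rightarrow> real"
  assumes X [measurable]: "\<And>n. X n \<in> borel_measurable M"
    and Y [measurable]: "\<And>n. Y n \<in> borel_measurable M"
    and N: "real_distribution N"
    and conv: "weak_conv_m (\<lambda>n. distr M borel (X n)) N"
    and diff: "\<And>\<epsilon>. 0 < \<epsilon> \<Longrightarrow> (\<lambda>n. prob {\<omega> \<in> space M. \<epsilon> < \<bar>Y n \<omega> - X n \<omega>\<bar>}) \<longlonglongrightarrow> 0"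
  shows "weak_conv_m (\<lambda>n. distr M borel (Y n)) N"
proof (rule levy_continuity)
  show "real_distribution (distr M borel (Y n))" for n by simp
  show "real_distribution N" by fact
  fix t :: real
  let ?c = "\<lambda>Z n. char (distr M borel (Z n)) t"
  have bound: "cmod (?c Y n - ?c X n)
      \<le> \<bar>t\<bar> * \<epsilon> + 2 * prob {\<omega> \<in> space M. \<epsilon> < \<bar>Y n \<omega> - X n \<omega>\<bar>}" if "0 < \<epsilon>" for n \<epsilon>
  proof -
    let ?A = "{\<omega> \<in> space M. \<epsilon> < \<bar>Y n \<omega> - X n \<omega>\<bar>}"
    have A [measurable]: "?A \<in> sets M" by measurable
    have int: "integrable M (\<lambda>\<omega>. iexp (t * Z \<omega>))" if [measurable]: "Z \<in> borel_measurable M" for Z :: "'a \<Rightarrow> real"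
      by (rule integrable_iexp) auto
    have "?c Y n - ?c X n = (CLINT \<omega>|M. iexp (t * Y n \<omega>) - iexp (t * X n \<omega>))"
      unfolding char_def
      by (subst Bochner_Integration.integral_diff[OF int int]) (auto simp: integral_distr)
    also have "cmod \<dots> \<le> (\<integral>\<omega>. \<bar>t\<bar> * \<epsilon> + 2 * indicator ?A \<omega> \<partial>M)"
    proof (rule order.trans[OF integral_norm_bound integral_mono])
      show "integrable M (\<lambda>\<omega>. cmod (iexp (t * Y n \<omega>) - iexp (t * X n \<omega>)))"
        by (intro integrable_norm Bochner_Integration.integrable_diff int X Y)
      show "integrable M (\<lambda>\<omega>. \<bar>t\<bar> * \<epsilon> + 2 * indicator ?A \<omega> :: real)"
        by (intro Bochner_Integration.integrable_add integrable_const integrable_mult_right)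
          (simp add: emeasure_eq_measure)
      fix \<omega> assume \<omega>: "\<omega> \<in> space M"
      have "iexp (t * Y n \<omega>) - iexp (t * X n \<omega>)
          = iexp (t * X n \<omega>) * (iexp (t * (Y n \<omega> - X n \<omega>)) - 1)"
        by (simp add: algebra_simps flip: exp_add)
      then have eq: "cmod (iexp (t * Y n \<omega>) - iexp (t * X n \<omega>))
          = cmod (iexp (t * (Y n \<omega> - X n \<omega>)) - 1)"
        by (simp add: norm_mult)
      show "cmod (iexp (t * Y n \<omega>) - iexp (t * X n \<omega>)) \<le> \<bar>t\<bar> * \<epsilon> + 2 * indicator ?A \<omega>"
      proof (cases "\<omega> \<in> ?A")
        case True
        have "cmod (iexp (t * Y n \<omega>) - iexp (t * X n \<omega>)) \<le> 2"
          using norm_triangle_ineq4[of "iexp (t * Y n \<omega>)" "iexp (t * X n \<omega>)"] by simp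
        then show ?thesis using True that by (auto simp: add_increasing)
      next
        case False
        have "cmod (iexp (t * (Y n \<omega> - X n \<omega>)) - 1) \<le> \<bar>t * (Y n \<omega> - X n \<omega>)\<bar>"
          using iexp_approx1[of "t * (Y n \<omega> - X n \<omega>)" 0] by simp
        also have "\<dots> \<le> \<bar>t\<bar> * \<epsilon>"
          using False \<omega> by (auto simp: abs_mult intro!: mult_left_mono)
        finally show ?thesis using False eq by simp
      qed
    qed
    also have "\<dots> = \<bar>t\<bar> * \<epsilon> + 2 * prob ?A"
      by (subst Bochner_Integration.integral_add) (auto simp: prob_space emeasure_eq_measure)
    finally show ?thesis .
  qed
  have "(\<lambda>n. ?c Y n - ?c X n) \<longlonglongrightarrow> 0"
  proof (rule LIMSEQ_I)
    fix r :: real assume r: "0 < r"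
    define \<epsilon> where "\<epsilon> = r / (2 * (\<bar>t\<bar> + 1))"
    have \<epsilon>: "0 < \<epsilon>" using r by (simp add: \<epsilon>_def)
    have t\<epsilon>: "\<bar>t\<bar> * \<epsilon> < r / 2"
      using r by (simp add: \<epsilon>_def field_simps)
    from LIMSEQ_D[OF diff[OF \<epsilon>], of "r / 4"] r
    obtain n0 where n0: "\<And>n. n \<ge> n0 \<Longrightarrow> prob {\<omega> \<in> space M. \<epsilon> < \<bar>Y n \<omega> - X n \<omega>\<bar>} < r / 4"
      by auto
    have "cmod (?c Y n - ?c X n - 0) < r" if "n \<ge> n0" for n
      using bound[OF \<epsilon>, of n] n0[OF that] t\<epsilon> by simp
    then show "\<exists>n0. \<forall>n\<ge>n0. cmod (?c Y n - ?c X n - 0) < r" by blast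
  qed
  moreover have "(\<lambda>n. ?c X n) \<longlonglongrightarrow> char N t"
    by (rule levy_continuity1[OF _ N conv]) simp
  ultimately have "(\<lambda>n. (?c Y n - ?c X n) + ?c X n) \<longlonglongrightarrow> 0 + char N t"
    by (rule tendsto_add)
  then show "(\<lambda>n. ?c Y n) \<longlonglongrightarrow> char N t" by simp
qed

lemma weak_conv_m_scale:
  fixes c :: real
  assumes c: "0 < c"
    and Ms: "\<And>n. sets (Ms n) = sets borel" and N: "sets N = sets borel"
    and conv: "weak_conv_m Ms N"
  shows "weak_conv_m (\<lambda>n. distr (Ms n) borel ((*) c)) (distr N borel ((*) c))"
proof -
  have cdf: "cdf (distr L borel ((*) c)) x = cdf L (x / c)" if "sets L = sets borel" for L x
  proof -
    have [simp]: "space L = UNIV" using sets_eq_imp_space_eq[OF that] by simp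
    have "(*) c -` {..x} = {..x / c}"
      using c by (auto simp: field_simps)
    moreover have "(*) c \<in> borel_measurable L"
      by (subst measurable_cong_sets[OF that refl]) simp
    ultimately show ?thesis
      by (simp add: cdf_def measure_distr)
  qed
  show ?thesis
    unfolding weak_conv_m_def weak_conv_def
  proof (intro allI impI)
    fix x assume cont: "isCont (cdf (distr N borel ((*) c))) x"
    have *: "cdf (distr N borel ((*) c)) = (\<lambda>x. cdf N (x / c))"
      using cdf[OF N] by auto
    have "isCont (\<lambda>y. cdf N ((c * y) / c)) (x / c)"
    proof (rule isCont_o2[where f = "(*) c" and g = "\<lambda>x. cdf N (x / c)"])
      show "isCont ((*) c) (x / c)" by (intro continuous_intros)
      show "isCont (\<lambda>x. cdf N (x / c)) (c * (x / c))" using cont c unfolding * by simp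
    qed
    then have "isCont (cdf N) (x / c)"
      using c by simp
    with conv have "(\<lambda>n. cdf (Ms n) (x / c)) \<longlonglongrightarrow> cdf N (x / c)"
      unfolding weak_conv_m_def weak_conv_def by blast
    then show "(\<lambda>n. cdf (distr (Ms n) borel ((*) c)) x) \<longlonglongrightarrow> cdf (distr N borel ((*) c)) x"
      unfolding cdf[OF Ms] cdf[OF N] .
  qed
qed

lemma distr_std_normal_scale:
  assumes "0 < c"
  shows "distr std_normal_distribution borel ((*) c) = normal_law 0 (c\<^sup>2)"
proof -
  interpret prob_space std_normal_distribution by (rule prob_space_normal_density) simp
  have "distributed std_normal_distribution lborel (\<lambda>x. x) std_normal_density"
    by (auto simp: distributed_def distr_id2 intro!: measurable_ident_sets)
  from normal_density_affine[OF this, of c 0] assms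
  have "distributed std_normal_distribution lborel ((*) c) (normal_density 0 c)"
    by simp
  then have "distr std_normal_distribution lborel ((*) c) = density lborel (normal_density 0 c)"
    by (simp add: distributed_def)
  moreover have "distr std_normal_distribution lborel ((*) c) = distr std_normal_distribution borel ((*) c)"
    by (rule distr_cong) auto
  ultimately show ?thesis using assms by (simp add: normal_law_def)
qed

section \<open>Second moments of sums and of degenerate U-statistics\<close>

lemma integrable_mult_of_squares:
  fixes f g :: "'a \<Rightarrow> real"
  assumes [measurable]: "f \<in> borel_measurable M" "g \<in> borel_measurable M"
    and "integrable M (\<lambda>x. (f x)\<^sup>2)" "integrable M (\<lambda>x. (g x)\<^sup>2)"
  shows "integrable M (\<lambda>x. f x * g x)"
proof (rule Bochner_Integration.integrable_bound)
  show "integrable M (\<lambda>x. (f x)\<^sup>2 + (g x)\<^sup>2)" using assms by simp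
  have "norm (f x * g x) \<le> norm ((f x)\<^sup>2 + (g x)\<^sup>2)" for x
  proof -
    have "2 * \<bar>f x * g x\<bar> \<le> (f x)\<^sup>2 + (g x)\<^sup>2"
      using sum_squares_bound[of "\<bar>f x\<bar>" "\<bar>g x\<bar>"] by (simp add: abs_mult)
    then show ?thesis by simp
  qed
  then show "AE x in M. norm (f x * g x) \<le> norm ((f x)\<^sup>2 + (g x)\<^sup>2)" by simp
qed simp

lemma expectation_square_orthogonal_sum:
  fixes Y :: "'i \<Rightarrow> 'a \<Rightarrow> real"
  assumes "finite A"
    and [measurable]: "\<And>p. p \<in> A \<Longrightarrow> Y p \<in> borel_measurable M"
    and sq: "\<And>p. p \<in> A \<Longrightarrow> integrable M (\<lambda>\<omega>. (Y p \<omega>)\<^sup>2)"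
    and orth: "\<And>p q. p \<in> A \<Longrightarrow> q \<in> A \<Longrightarrow> p \<noteq> q \<Longrightarrow> (\<integral>\<omega>. Y p \<omega> * Y q \<omega> \<partial>M) = 0"
  shows "integrable M (\<lambda>\<omega>. (\<Sum>p\<in>A. Y p \<omega>)\<^sup>2)"
    and "(\<integral>\<omega>. (\<Sum>p\<in>A. Y p \<omega>)\<^sup>2 \<partial>M) = (\<Sum>p\<in>A. \<integral>\<omega>. (Y p \<omega>)\<^sup>2 \<partial>M)"
proof -
  have int: "integrable M (\<lambda>\<omega>. Y p \<omega> * Y q \<omega>)" if "p \<in> A" "q \<in> A" for p q
    using that sq by (intro integrable_mult_of_squares) auto
  have eq: "(\<lambda>\<omega>. (\<Sum>p\<in>A. Y p \<omega>)\<^sup>2) = (\<lambda>\<omega>. \<Sum>p\<in>A. \<Sum>q\<in>A. Y p \<omega> * Y q \<omega>)"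
    by (simp add: power2_eq_square sum_product)
  show "integrable M (\<lambda>\<omega>. (\<Sum>p\<in>A. Y p \<omega>)\<^sup>2)"
    unfolding eq by (intro Bochner_Integration.integrable_sum int)
  have "(\<integral>\<omega>. (\<Sum>p\<in>A. Y p \<omega>)\<^sup>2 \<partial>M) = (\<Sum>p\<in>A. \<Sum>q\<in>A. \<integral>\<omega>. Y p \<omega> * Y q \<omega> \<partial>M)"
    unfolding eq using int by (simp add: Bochner_Integration.integral_sum Bochner_Integration.integrable_sum)
  also have "\<dots> = (\<Sum>p\<in>A. \<Sum>q\<in>A. if q = p then \<integral>\<omega>. (Y p \<omega>)\<^sup>2 \<partial>M else 0)"
    using orth by (intro sum.cong refl) (auto simp: power2_eq_square)
  also have "\<dots> = (\<Sum>p\<in>A. \<integral>\<omega>. (Y p \<omega>)\<^sup>2 \<partial>M)"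
    using \<open>finite A\<close> by simp
  finally show "(\<integral>\<omega>. (\<Sum>p\<in>A. Y p \<omega>)\<^sup>2 \<partial>M) = (\<Sum>p\<in>A. \<integral>\<omega>. (Y p \<omega>)\<^sup>2 \<partial>M)" .
qed

text \<open>
  Fubini for an integrand whose sections already integrate to zero.  Both variables
  take values in one type because \<open>indep_var\<close> is a family indexed by the Booleans.
\<close>

lemma (in prob_space) indep_var_expectation_zero:
  fixes G :: "'b \<Rightarrow> 'b \<Rightarrow> real"
  assumes ind: "indep_var S X T Z"
    and G [measurable]: "case_prod G \<in> borel_measurable (S \<Otimes>\<^sub>M T)"
    and int: "integrable M (\<lambda>\<omega>. G (X \<omega>) (Z \<omega>))"
    and zero: "\<And>z. z \<in> space T \<Longrightarrow> (\<integral>x. G x z \<partial>distr M S X) = 0"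
  shows "expectation (\<lambda>\<omega>. G (X \<omega>) (Z \<omega>)) = 0"
proof -
  have [measurable]: "X \<in> measurable M S" "Z \<in> measurable M T"
    using ind by (auto dest: indep_var_rv1 indep_var_rv2)
  interpret X: prob_space "distr M S X" by (rule prob_space_distr) simp
  interpret Z: prob_space "distr M T Z" by (rule prob_space_distr) simp
  interpret XZ: pair_prob_space "distr M S X" "distr M T Z" ..
  have joint: "distr M S X \<Otimes>\<^sub>M distr M T Z = distr M (S \<Otimes>\<^sub>M T) (\<lambda>\<omega>. (X \<omega>, Z \<omega>))"
    using ind by (simp add: indep_var_distribution_eq)
  have int': "integrable (distr M S X \<Otimes>\<^sub>M distr M T Z) (case_prod G)"
    unfolding joint using int by (subst integrable_distr_eq) auto
  have "expectation (\<lambda>\<omega>. G (X \<omega>) (Z \<omega>)) = integral\<^sup>L (distr M S X \<Otimes>\<^sub>M distr M T Z) (case_prod G)"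
    unfolding joint by (subst integral_distr) auto
  also have "\<dots> = (\<integral>z. (\<integral>x. G x z \<partial>distr M S X) \<partial>distr M T Z)"
    using XZ.integral_snd[OF int'] by simp
  also have "\<dots> = (\<integral>z. 0 \<partial>distr M T Z)"
    using zero by (intro Bochner_Integration.integral_cong) auto
  finally show ?thesis by simp
qed

lemma sum_offdiagonal:
  fixes f :: "nat \<Rightarrow> nat \<Rightarrow> real"
  assumes sym: "\<And>i j. f i j = f j i"
  shows "(\<Sum>i=1..n. \<Sum>j\<in>{1..n}-{i}. f i j) = 2 * (\<Sum>(i,j)\<in>{(i,j). 1 \<le> i \<and> i < j \<and> j \<le> n}. f i j)"
proof -
  let ?L = "{(i,j). 1 \<le> i \<and> i < j \<and> j \<le> n}" and ?U = "{(i,j). 1 \<le> j \<and> j < i \<and> i \<le> n}"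
  have fin: "finite ?L" "finite ?U"
    by (rule finite_subset[of _ "{1..n} \<times> {1..n}"], auto)+
  have "(\<Sum>i=1..n. \<Sum>j\<in>{1..n}-{i}. f i j) = (\<Sum>(i,j)\<in>(SIGMA i:{1..n}. {1..n}-{i}). f i j)"
    by (subst sum.Sigma) auto
  also have "(SIGMA i:{1..n}. {1..n}-{i}) = ?L \<union> ?U" by auto
  also have "(\<Sum>(i,j)\<in>?L \<union> ?U. f i j) = (\<Sum>(i,j)\<in>?L. f i j) + (\<Sum>(i,j)\<in>?U. f i j)"
    using fin by (intro sum.union_disjoint) auto
  also have "(\<Sum>(i,j)\<in>?U. f i j) = (\<Sum>(i,j)\<in>?L. f i j)"
    by (rule sum.reindex_bij_witness[of _ prod.swap prod.swap]) (auto simp: sym)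
  finally show ?thesis by simp
qed

lemma (in prob_space) joint_law_pair:
  fixes X :: "nat \<Rightarrow> 'a \<Rightarrow> real"
  assumes ind: "indep_vars (\<lambda>_. borel) X I" and law: "\<And>i. i \<in> I \<Longrightarrow> distr M borel (X i) = P"
    and "i \<in> I" "j \<in> I" "i \<noteq> j"
  shows "distr M (borel \<Otimes>\<^sub>M borel) (\<lambda>\<omega>. (X i \<omega>, X j \<omega>)) = P \<Otimes>\<^sub>M P"
proof -
  have "indep_var borel (X i) borel (X j)"
    using assms indep_var_compose[OF indep_var_restrict[OF ind, of "{i}" "{j}"],
        where ?Y1.0 = "\<lambda>f. f i" and ?Y2.0 = "\<lambda>f. f j" and ?N1.0 = borel and ?N2.0 = borel]
    by (simp add: comp_def measurable_component_singleton)
  then show ?thesis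
    using assms by (simp add: indep_var_distribution_eq)
qed


text \<open>
  The reason why degenerate kernels decouple: the index \<open>m\<close> occurs nowhere in the factor \<open>k\<close>, so
  one can integrate over \<open>X\<^sub>m\<close> alone, the other coordinates being frozen, and this gives zero.
\<close>

lemma (in prob_space) degenerate_kernel_orthogonal:
  fixes X :: "nat \<Rightarrow> 'a \<Rightarrow> real" and g :: "real \<Rightarrow> real \<Rightarrow> real"
    and k :: "(nat \<Rightarrow> real) \<Rightarrow> real"
  assumes ind: "indep_vars (\<lambda>_. borel) X I" and law: "\<And>i. i \<in> I \<Longrightarrow> distr M borel (X i) = P"
    and g [measurable]: "case_prod g \<in> borel_measurable (borel \<Otimes>\<^sub>M borel)"
    and deg: "\<And>y. (\<integral>x. g x y \<partial>P) = 0"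
    and m: "m \<in> I" "m \<notin> J" and J: "J \<subseteq> I" "l \<in> J"
    and k [measurable]: "k \<in> borel_measurable (PiM J (\<lambda>_. borel))"
    and int: "integrable M (\<lambda>\<omega>. g (X m \<omega>) (X l \<omega>) * k (restrict (\<lambda>i. X i \<omega>) J))"
  shows "expectation (\<lambda>\<omega>. g (X m \<omega>) (X l \<omega>) * k (restrict (\<lambda>i. X i \<omega>) J)) = 0"
proof -
  define G where "G x z = g (x m) (z l) * k z" for x z :: "nat \<Rightarrow> real"
  have X [measurable]: "X i \<in> borel_measurable M" if "i \<in> I" for i
    using ind that by (auto simp: indep_vars_def)
  have iv: "indep_var (PiM {m} (\<lambda>_. borel)) (\<lambda>\<omega>. restrict (\<lambda>i. X i \<omega>) {m})
      (PiM J (\<lambda>_. borel)) (\<lambda>\<omega>. restrict (\<lambda>i. X i \<omega>) J)"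
    using m J by (intro indep_var_restrict[OF ind]) auto
  have Xm [measurable]: "(\<lambda>\<omega>. restrict (\<lambda>i. X i \<omega>) {m}) \<in> measurable M (PiM {m} (\<lambda>_. borel))"
    using iv by (rule indep_var_rv1)
  have [measurable]: "(\<lambda>z. z l) \<in> borel_measurable (PiM J (\<lambda>_. borel :: real measure))"
    using J by (intro measurable_component_singleton)
  have [measurable]: "(\<lambda>x. x m) \<in> borel_measurable (PiM {m} (\<lambda>_. borel :: real measure))"
    by (intro measurable_component_singleton) simp
  have G_eq: "G (restrict (\<lambda>i. X i \<omega>) {m}) (restrict (\<lambda>i. X i \<omega>) J)
      = g (X m \<omega>) (X l \<omega>) * k (restrict (\<lambda>i. X i \<omega>) J)" for \<omega>
    using J by (simp add: G_def)
  have G_meas: "case_prod G \<in> borel_measurable (PiM {m} (\<lambda>_. borel) \<Otimes>\<^sub>M PiM J (\<lambda>_. borel))"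
    unfolding G_def case_prod_beta by measurable
  have zero: "(\<integral>x. G x z \<partial>distr M (PiM {m} (\<lambda>_. borel)) (\<lambda>\<omega>. restrict (\<lambda>i. X i \<omega>) {m})) = 0" for z
  proof -
    have "(\<integral>x. G x z \<partial>distr M (PiM {m} (\<lambda>_. borel)) (\<lambda>\<omega>. restrict (\<lambda>i. X i \<omega>) {m}))
        = (\<integral>\<omega>. g (X m \<omega>) (z l) * k z \<partial>M)"
      unfolding G_def by (subst integral_distr) simp_all
    also have "\<dots> = (\<integral>\<omega>. g (X m \<omega>) (z l) \<partial>M) * k z" by simp
    also have "(\<integral>\<omega>. g (X m \<omega>) (z l) \<partial>M) = (\<integral>x. g x (z l) \<partial>distr M borel (X m))"
      using m by (subst integral_distr) auto
    also have "\<dots> = 0" using law m deg by simp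
    finally show ?thesis by (simp only: mult_zero_left)
  qed
  have "expectation (\<lambda>\<omega>. G (restrict (\<lambda>i. X i \<omega>) {m}) (restrict (\<lambda>i. X i \<omega>) J)) = 0"
  proof (rule indep_var_expectation_zero[OF iv G_meas])
    show "integrable M (\<lambda>\<omega>. G (restrict (\<lambda>i. X i \<omega>) {m}) (restrict (\<lambda>i. X i \<omega>) J))"
      unfolding G_eq by (rule int)
  qed (rule zero)
  then show ?thesis unfolding G_eq .
qed

text \<open>
  Only the \<open>n (n - 1) / 2\<close> diagonal terms survive in the expanded square, whereas a centred kernel without
  the degeneracy condition would contribute of order \<open>n\<^sup>3\<close>.  This is what makes the remainder in the
  Hoeffding decomposition negligible.
\<close>

lemma (in prob_space) degenerate_U_statistic_second_moment:
  fixes X :: "nat \<Rightarrow> 'a \<Rightarrow> real" and g :: "real \<Rightarrow> real \<Rightarrow> real"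
  assumes ind: "indep_vars (\<lambda>_. borel) X {1..}" and law: "\<And>i. 1 \<le> i \<Longrightarrow> distr M borel (X i) = P"
    and g [measurable]: "case_prod g \<in> borel_measurable (borel \<Otimes>\<^sub>M borel)"
    and sym: "\<And>x y. g x y = g y x"
    and deg: "\<And>y. (\<integral>x. g x y \<partial>P) = 0"
    and sq: "integrable (P \<Otimes>\<^sub>M P) (\<lambda>z. (g (fst z) (snd z))\<^sup>2)"
  defines "S n \<omega> \<equiv> \<Sum>i=1..n. \<Sum>j\<in>{1..n}-{i}. g (X i \<omega>) (X j \<omega>)"
  shows "integrable M (\<lambda>\<omega>. (S n \<omega>)\<^sup>2)"
    and "expectation (\<lambda>\<omega>. (S n \<omega>)\<^sup>2)
      = 2 * real n * (real n - 1) * (\<integral>z. (g (fst z) (snd z))\<^sup>2 \<partial>(P \<Otimes>\<^sub>M P))"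
proof -
  let ?c = "\<integral>z. (g (fst z) (snd z))\<^sup>2 \<partial>(P \<Otimes>\<^sub>M P)"
  let ?A = "{(i,j). 1 \<le> i \<and> i < j \<and> j \<le> n}"
  let ?Y = "\<lambda>p \<omega>. g (X (fst p) \<omega>) (X (snd p) \<omega>)"
  have fin: "finite ?A" by (rule finite_subset[of _ "{1..n} \<times> {1..n}"]) auto
  have X [measurable]: "X i \<in> borel_measurable M" if "1 \<le> i" for i
    using ind that by (auto simp: indep_vars_def)
  have Y [measurable]: "?Y p \<in> borel_measurable M" if "p \<in> ?A" for p
  proof -
    have [measurable]: "X (fst p) \<in> borel_measurable M" "X (snd p) \<in> borel_measurable M"
      using that by (auto intro!: X)
    show ?thesis by measurable
  qed
  have pair: "P \<Otimes>\<^sub>M P = distr M (borel \<Otimes>\<^sub>M borel) (\<lambda>\<omega>. (X i \<omega>, X j \<omega>))" if "1 \<le> i" "i < j" for i j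
    by (rule joint_law_pair[OF ind, symmetric]) (use that law in auto)
  have Ysq: "integrable M (\<lambda>\<omega>. (?Y p \<omega>)\<^sup>2)" and Yc: "(\<integral>\<omega>. (?Y p \<omega>)\<^sup>2 \<partial>M) = ?c"
    if p: "p \<in> ?A" for p
  proof -
    obtain i j where p': "p = (i,j)" "1 \<le> i" "i < j" using p by auto
    have [measurable]: "X i \<in> borel_measurable M" "X j \<in> borel_measurable M"
      using p' by auto
    have "integrable M ((\<lambda>z. (g (fst z) (snd z))\<^sup>2) \<circ> (\<lambda>\<omega>. (X i \<omega>, X j \<omega>)))"
      using sq unfolding pair[OF p'(2,3)] comp_def by (subst (asm) integrable_distr_eq) auto
    then show "integrable M (\<lambda>\<omega>. (?Y p \<omega>)\<^sup>2)" using p' by (simp add: comp_def)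
    show "(\<integral>\<omega>. (?Y p \<omega>)\<^sup>2 \<partial>M) = ?c"
      unfolding pair[OF p'(2,3)] using p' by (subst integral_distr) auto
  qed
  have orth: "(\<integral>\<omega>. ?Y p \<omega> * ?Y q \<omega> \<partial>M) = 0" if p: "p \<in> ?A" and q: "q \<in> ?A" and ne: "p \<noteq> q" for p q
  proof -
    obtain i j where p': "p = (i,j)" "1 \<le> i" "i < j" using p by auto
    obtain a b where q': "q = (a,b)" "1 \<le> a" "a < b" using q by auto
    have int: "integrable M (\<lambda>\<omega>. ?Y p \<omega> * ?Y q \<omega>)"
      by (rule integrable_mult_of_squares) (use p q Y Ysq in auto)
    have key: "expectation (\<lambda>\<omega>. g (X m \<omega>) (X l \<omega>) * g (X a \<omega>) (X b \<omega>)) = 0"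
      if m: "m \<noteq> l" "m \<noteq> a" "m \<noteq> b" "1 \<le> m" "1 \<le> l"
        and eq: "\<And>\<omega>. ?Y p \<omega> = g (X m \<omega>) (X l \<omega>)" for m l
    proof -
      let ?J = "{l, a, b}"
      have [measurable]: "(\<lambda>z. z a) \<in> borel_measurable (PiM ?J (\<lambda>_. borel :: real measure))"
        "(\<lambda>z. z b) \<in> borel_measurable (PiM ?J (\<lambda>_. borel :: real measure))"
        by (auto intro!: measurable_component_singleton)
      have "expectation (\<lambda>\<omega>. g (X m \<omega>) (X l \<omega>)
          * (\<lambda>z. g (z a) (z b)) (restrict (\<lambda>i. X i \<omega>) ?J)) = 0"
      proof (rule degenerate_kernel_orthogonal[OF ind _ g deg])
        show "(\<lambda>z. g (z a) (z b)) \<in> borel_measurable (PiM ?J (\<lambda>_. borel))" by measurable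
        show "integrable M (\<lambda>\<omega>. g (X m \<omega>) (X l \<omega>)
          * (\<lambda>z. g (z a) (z b)) (restrict (\<lambda>i. X i \<omega>) ?J))"
          using int unfolding eq using q' by simp
      qed (use m q' law in auto)
      then show ?thesis by simp
    qed
    \<comment> \<open>Pairs are listed in increasing order, so distinct ones cannot have the same entries: some
      index of the first pair is missing from the second, and one can integrate over it.\<close>
    consider "i \<noteq> a" "i \<noteq> b" | "j \<noteq> a" "j \<noteq> b"
      using ne p' q' by force
    then show ?thesis
    proof cases
      case 1
      then show ?thesis using key[of i j] p' q' by simp
    next
      case 2
      moreover have "?Y p \<omega> = g (X j \<omega>) (X i \<omega>)" for \<omega>
        unfolding p'(1) fst_conv snd_conv by (rule sym)
      ultimately have "expectation (\<lambda>\<omega>. g (X j \<omega>) (X i \<omega>) * g (X a \<omega>) (X b \<omega>)) = 0"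
        using p' q' by (intro key) auto
      then show ?thesis
        unfolding p'(1) q'(1) fst_conv snd_conv sym[of "X i _"] .
    qed
  qed
  have S: "S n \<omega> = 2 * (\<Sum>p\<in>?A. ?Y p \<omega>)" for \<omega>
    unfolding S_def by (subst sum_offdiagonal) (rule sym, simp add: case_prod_beta)
  have "(\<Sum>i=1..n. \<Sum>j\<in>{1..n}-{i}. 1::real) = 2 * (\<Sum>(i,j)\<in>?A. 1)"
    by (rule sum_offdiagonal) simp
  moreover have "(\<Sum>i=1..n. \<Sum>j\<in>{1..n}-{i}. 1::real) = real n * (real n - 1)"
  proof -
    have "(\<Sum>i=1..n. \<Sum>j\<in>{1..n}-{i}. 1::real) = (\<Sum>i=1..n. real n - 1)"
      by (intro sum.cong refl) (auto simp: of_nat_diff)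
    then show ?thesis by simp
  qed
  ultimately have card: "2 * real (card ?A) = real n * (real n - 1)"
    by (simp add: case_prod_beta)
  have "integrable M (\<lambda>\<omega>. (\<Sum>p\<in>?A. ?Y p \<omega>)\<^sup>2)"
    by (rule expectation_square_orthogonal_sum[OF fin Y Ysq orth])
  then show "integrable M (\<lambda>\<omega>. (S n \<omega>)\<^sup>2)"
    unfolding S by (simp add: power_mult_distrib)
  have "expectation (\<lambda>\<omega>. (\<Sum>p\<in>?A. ?Y p \<omega>)\<^sup>2) = (\<Sum>p\<in>?A. expectation (\<lambda>\<omega>. (?Y p \<omega>)\<^sup>2))"
    by (rule expectation_square_orthogonal_sum[OF fin Y Ysq orth])
  also have "\<dots> = real (card ?A) * ?c" using Yc by simp
  finally have "expectation (\<lambda>\<omega>. (\<Sum>p\<in>?A. ?Y p \<omega>)\<^sup>2) = real (card ?A) * ?c" .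
  then have "expectation (\<lambda>\<omega>. (S n \<omega>)\<^sup>2) = 2 * (2 * real (card ?A)) * ?c"
    unfolding S by (simp add: power_mult_distrib)
  then show "expectation (\<lambda>\<omega>. (S n \<omega>)\<^sup>2) = 2 * real n * (real n - 1) * ?c"
    unfolding card by simp
qed

lemma integrable_square_add:
  fixes f g :: "'a \<Rightarrow> real"
  assumes [measurable]: "f \<in> borel_measurable M" "g \<in> borel_measurable M"
    and f: "integrable M (\<lambda>x. (f x)\<^sup>2)" and g: "integrable M (\<lambda>x. (g x)\<^sup>2)"
  shows "integrable M (\<lambda>x. (f x + g x)\<^sup>2)"
  unfolding power2_sum
  using integrable_mult_of_squares[OF _ _ f g] f g
  by (simp add: mult.assoc)

lemma (in prob_space) centered_sum_second_moment:
  fixes X :: "nat \<Rightarrow> 'a \<Rightarrow> real" and f :: "real \<Rightarrow> real"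
  assumes ind: "indep_vars (\<lambda>_. borel) X {1..}" and law: "\<And>i. 1 \<le> i \<Longrightarrow> distr M borel (X i) = P"
    and f [measurable]: "f \<in> borel_measurable borel"
    and zero: "(\<integral>x. f x \<partial>P) = 0" and sq: "integrable P (\<lambda>x. (f x)\<^sup>2)"
  shows "integrable M (\<lambda>\<omega>. (\<Sum>i=1..n. f (X i \<omega>))\<^sup>2)"
    and "expectation (\<lambda>\<omega>. (\<Sum>i=1..n. f (X i \<omega>))\<^sup>2) = real n * (\<integral>x. (f x)\<^sup>2 \<partial>P)"
proof -
  have X [measurable]: "X i \<in> borel_measurable M" if "i \<in> {1..n}" for i
    using ind that by (auto simp: indep_vars_def)
  have fX [measurable]: "(\<lambda>\<omega>. f (X i \<omega>)) \<in> borel_measurable M" if "i \<in> {1..n}" for i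
    using X[OF that] by measurable
  have fsq: "integrable M (\<lambda>\<omega>. (f (X i \<omega>))\<^sup>2)"
    and fE: "expectation (\<lambda>\<omega>. (f (X i \<omega>))\<^sup>2) = (\<integral>x. (f x)\<^sup>2 \<partial>P)" if i: "i \<in> {1..n}" for i
  proof -
    have P: "P = distr M borel (X i)" using law i by simp
    show "integrable M (\<lambda>\<omega>. (f (X i \<omega>))\<^sup>2)"
      using sq X[OF i] unfolding P by (subst (asm) integrable_distr_eq) auto
    show "expectation (\<lambda>\<omega>. (f (X i \<omega>))\<^sup>2) = (\<integral>x. (f x)\<^sup>2 \<partial>P)"
      using X[OF i] unfolding P by (subst integral_distr) auto
  qed
  have orth: "expectation (\<lambda>\<omega>. f (X i \<omega>) * f (X j \<omega>)) = 0"
    if i: "i \<in> {1..n}" and j: "j \<in> {1..n}" and ne: "i \<noteq> j" for i j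
  proof (rule indep_var_expectation_zero[of borel "X i" borel "X j" "\<lambda>x y. f x * f y"])
    have "indep_var borel ((\<lambda>z. z i) \<circ> (\<lambda>\<omega>. restrict (\<lambda>i. X i \<omega>) {i}))
        borel ((\<lambda>z. z j) \<circ> (\<lambda>\<omega>. restrict (\<lambda>i. X i \<omega>) {j}))"
      using i j ne
      by (intro indep_var_compose[OF indep_var_restrict[OF ind]] measurable_component_singleton) auto
    then show "indep_var borel (X i) borel (X j)" by (simp add: comp_def)
    show "integrable M (\<lambda>\<omega>. f (X i \<omega>) * f (X j \<omega>))"
      by (rule integrable_mult_of_squares[OF fX[OF i] fX[OF j] fsq[OF i] fsq[OF j]])
    show "(\<integral>x. f x * f z \<partial>distr M borel (X i)) = 0" for z
      using law i zero by simp
  qed measurable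
  show "integrable M (\<lambda>\<omega>. (\<Sum>i=1..n. f (X i \<omega>))\<^sup>2)"
    by (rule expectation_square_orthogonal_sum(1)) (use fX fsq orth in auto)
  have "expectation (\<lambda>\<omega>. (\<Sum>i=1..n. f (X i \<omega>))\<^sup>2) = (\<Sum>i=1..n. expectation (\<lambda>\<omega>. (f (X i \<omega>))\<^sup>2))"
    by (rule expectation_square_orthogonal_sum(2)) (use fX fsq orth in auto)
  also have "\<dots> = real n * (\<integral>x. (f x)\<^sup>2 \<partial>P)" using fE by simp
  finally show "expectation (\<lambda>\<omega>. (\<Sum>i=1..n. f (X i \<omega>))\<^sup>2) = real n * (\<integral>x. (f x)\<^sup>2 \<partial>P)" .
qed

text \<open>
  The central limit theorem in the form needed here: indices start at 1, a function of the
  observations is summed, and the limit is scaled to the variance \<open>(b \<sigma>)\<^sup>2\<close>.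
\<close>

lemma (in prob_space) centered_sum_clt:
  fixes X :: "nat \<Rightarrow> 'a \<Rightarrow> real" and f :: "real \<Rightarrow> real"
  assumes ind: "indep_vars (\<lambda>_. borel) X {1..}" and law: "\<And>i. 1 \<le> i \<Longrightarrow> distr M borel (X i) = P"
    and f [measurable]: "f \<in> borel_measurable borel"
    and zero: "(\<integral>x. f x \<partial>P) = 0" and sq: "integrable P (\<lambda>x. (f x)\<^sup>2)"
    and \<sigma>: "0 < \<sigma>" "(\<integral>x. (f x)\<^sup>2 \<partial>P) = \<sigma>\<^sup>2"
    and b: "0 < b"
  shows "weak_conv_m (\<lambda>n. distr M borel (\<lambda>\<omega>. b / sqrt (real n) * (\<Sum>i=1..n. f (X i \<omega>)))) (normal_law 0 ((b * \<sigma>)\<^sup>2))"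
proof -
  have X [measurable]: "X (Suc i) \<in> borel_measurable M" for i
    using ind by (auto simp: indep_vars_def)
  define Y where "Y i \<omega> = f (X (Suc i) \<omega>)" for i \<omega>
  have Y [measurable]: "Y i \<in> borel_measurable M" for i unfolding Y_def by measurable
  have P: "P = distr M borel (X (Suc i))" for i using law by simp
  have EY: "expectation (Y i) = 0" for i
    using zero unfolding P[of i] Y_def by (subst (asm) integral_distr) auto
  have sqY: "integrable M (\<lambda>\<omega>. (Y i \<omega>)\<^sup>2)" for i
    using sq unfolding P[of i] Y_def by (subst (asm) integrable_distr_eq) auto
  have varY: "variance (Y i) = \<sigma>\<^sup>2" for i
    unfolding EY using \<sigma>(2) unfolding P[of i] Y_def by (subst (asm) integral_distr) auto
  have lawY: "distr M borel (Y i) = distr P borel f" for i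
    unfolding P[of i] Y_def by (subst distr_distr) (auto simp: comp_def)
  have indY: "indep_vars (\<lambda>_. borel) Y UNIV"
  proof -
    have "indep_vars (\<lambda>j. PiM {Suc j} (\<lambda>_. borel)) (\<lambda>j \<omega>. restrict (\<lambda>i. X i \<omega>) {Suc j}) UNIV"
      by (rule indep_vars_restrict[OF ind]) (auto simp: disjoint_family_on_def)
    then have "indep_vars (\<lambda>_. borel) (\<lambda>j \<omega>. f ((restrict (\<lambda>i. X i \<omega>) {Suc j}) (Suc j))) UNIV"
    proof (rule indep_vars_compose2[where Y = "\<lambda>j z. f (z (Suc j))"])
      fix j :: nat
      have [measurable]: "(\<lambda>z. z (Suc j)) \<in> borel_measurable (PiM {Suc j} (\<lambda>_. borel :: real measure))"
        by (rule measurable_component_singleton) simp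
      show "(\<lambda>z. f (z (Suc j))) \<in> borel_measurable (PiM {Suc j} (\<lambda>_. borel))" by measurable
    qed
    then show ?thesis unfolding Y_def by simp
  qed
  have "weak_conv_m (\<lambda>n. distr M borel (\<lambda>\<omega>. (\<Sum>i<n. Y i \<omega>) / sqrt (n * \<sigma>\<^sup>2))) std_normal_distribution"
    by (rule central_limit_theorem_zero_mean[OF indY EY \<sigma>(1) sqY varY lawY])
  then have "weak_conv_m (\<lambda>n. distr (distr M borel (\<lambda>\<omega>. (\<Sum>i<n. Y i \<omega>) / sqrt (n * \<sigma>\<^sup>2))) borel ((*) (b * \<sigma>)))
      (distr std_normal_distribution borel ((*) (b * \<sigma>)))"
    using b \<sigma>(1) by (intro weak_conv_m_scale) auto
  moreover have "distr (distr M borel (\<lambda>\<omega>. (\<Sum>i<n. Y i \<omega>) / sqrt (n * \<sigma>\<^sup>2))) borel ((*) (b * \<sigma>))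
      = distr M borel (\<lambda>\<omega>. b / sqrt (real n) * (\<Sum>i=1..n. f (X i \<omega>)))" for n :: nat
  proof -
    have "b * \<sigma> * ((\<Sum>i<n. Y i \<omega>) / sqrt (n * \<sigma>\<^sup>2)) = b / sqrt (real n) * (\<Sum>i=1..n. f (X i \<omega>))" for \<omega>
    proof -
      have "(\<Sum>i=1..n. f (X i \<omega>)) = (\<Sum>i<n. Y i \<omega>)" by (simp add: Y_def sum.atLeast1_atMost_eq)
      then show ?thesis using \<sigma>(1) by (simp add: real_sqrt_mult)
    qed
    then show ?thesis by (subst distr_distr) (auto simp: comp_def)
  qed
  ultimately show ?thesis
    using distr_std_normal_scale[of "b * \<sigma>"] b \<sigma>(1) by simp
qed

section \<open>The expected maximum with a constant\<close>

lemma interval_measure_cdf: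
  assumes "real_distribution N"
  shows "interval_measure (cdf N) = N"
proof -
  interpret real_distribution N by fact
  show ?thesis
  proof (rule cdf_unique)
    show "real_distribution (interval_measure (cdf N))"
      by (intro real_distribution_interval_measure cdf_nondecreasing cdf_is_right_cont
          cdf_lim_at_bot cdf_lim_at_top_prob)
    show "cdf (interval_measure (cdf N)) = cdf N"
      by (intro cdf_interval_measure cdf_nondecreasing cdf_is_right_cont cdf_lim_at_bot)
  qed fact
qed

lemma nonneg_dist_funD:
  assumes "nonneg_dist_fun H"
  shows "real_distribution (interval_measure H)" "AE z in interval_measure H. 0 \<le> z"
    "cdf (interval_measure H) = H"
proof -
  obtain N where N: "real_distribution N" "AE z in N. 0 \<le> z" "cdf N = H"
    using assms by (auto simp: nonneg_dist_fun_def)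
  then have "interval_measure H = N" using interval_measure_cdf by blast
  with N show "real_distribution (interval_measure H)" "AE z in interval_measure H. 0 \<le> z"
    "cdf (interval_measure H) = H" by (metis, metis, metis)
qed

lemma has_density_no_atoms:
  assumes "has_density H"
  shows "emeasure (interval_measure H) {x} = 0"
proof -
  obtain f where [measurable]: "f \<in> borel_measurable borel" and f: "interval_measure H = density lborel f"
    using assms by (auto simp: has_density_def)
  have "AE y in lborel. y \<noteq> x" by (rule AE_lborel_singleton)
  then have "AE y in density lborel f. y \<noteq> x" by (subst AE_density) auto
  then have "AE y in interval_measure H. y \<notin> {x}" unfolding f by simp
  then have "{x} \<in> null_sets (interval_measure H)"
    by (subst AE_iff_null_sets) auto
  then show ?thesis by auto
qed

lemma max_real_indicator:
  "max x t = x * indicator {..x} t + indicator {x<..} t * (t::real)"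
  by (auto simp: indicator_def)

context real_distribution
begin

lemma integrable_max_const:
  assumes "integrable M (\<lambda>t. t)"
  shows "integrable M (\<lambda>t. max x t)"
  using assms by simp

text \<open>
  Identifies the function inside the asymptotic variance: it is \<open>E (max x X)\<close>, split according to
  whether \<open>X \<le> x\<close>.  In this form convexity, linear growth and scaling are visible.
\<close>

lemma cdf_plus_upper_tail_integral:
  assumes int: "integrable M (\<lambda>t. t)"
  shows "x * cdf M x + (LINT t:{x<..}|M. t) = (\<integral>t. max x t \<partial>M)"
proof -
  have "(\<integral>t. max x t \<partial>M) = (\<integral>t. x * indicator {..x} t + indicator {x<..} t * t \<partial>M)"
    by (simp only: max_real_indicator)
  also have "\<dots> = (\<integral>t. x * indicator {..x} t \<partial>M) + (\<integral>t. indicator {x<..} t * t \<partial>M)"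
  proof (rule Bochner_Integration.integral_add)
    show "integrable M (\<lambda>t. x * indicator {..x} t)"
      by (intro integrable_mult_right) (simp add: emeasure_eq_measure)
    show "integrable M (\<lambda>t. indicator {x<..} t * t)"
      by (rule Bochner_Integration.integrable_bound[OF int]) (auto simp: indicator_def)
  qed
  finally show ?thesis
    by (simp add: cdf_def set_lebesgue_integral_def)
qed

lemma abs_integral_max_le:
  assumes int: "integrable M (\<lambda>t. t)"
  shows "\<bar>\<integral>t. max x t \<partial>M\<bar> \<le> \<bar>x\<bar> + (\<integral>t. \<bar>t\<bar> \<partial>M)"
proof -
  have "\<bar>\<integral>t. max x t \<partial>M\<bar> \<le> (\<integral>t. \<bar>max x t\<bar> \<partial>M)"
    by (rule integral_abs_bound)
  also have "\<dots> \<le> (\<integral>t. \<bar>x\<bar> + \<bar>t\<bar> \<partial>M)"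
    using int by (intro integral_mono) auto
  also have "\<dots> = \<bar>x\<bar> + (\<integral>t. \<bar>t\<bar> \<partial>M)"
    using int prob_space by simp
  finally show ?thesis .
qed

lemma AE_imp_ex_in_pos_measure:
  assumes "AE x in M. Q x" and B: "B \<in> sets M" and pos: "measure M B \<noteq> 0"
  obtains x where "x \<in> B" "Q x"
proof -
  have "\<exists>x\<in>B. Q x"
  proof (rule ccontr)
    assume "\<not> (\<exists>x\<in>B. Q x)"
    with assms(1) have "AE x in M. x \<notin> B" by (elim eventually_mono) auto
    then have "B \<in> null_sets M" using B by (simp add: AE_iff_null_sets)
    then show False using pos by (auto simp: measure_def null_sets_def)
  qed
  then show ?thesis using that by auto
qed

lemma cdf_attains:
  assumes atomless: "\<And>x. measure M {x} = 0" and p: "0 < p" "p < 1"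
  obtains q where "cdf M q = p"
proof -
  have cont: "isCont (cdf M) x" for x by (simp add: isCont_cdf atomless)
  have "eventually (\<lambda>x. cdf M x < p) at_bot"
    using order_tendstoD(2)[OF cdf_lim_at_bot p(1)] .
  then obtain a where a: "cdf M a < p" by (auto simp: eventually_at_bot_linorder)
  have "eventually (\<lambda>x. p < cdf M x) at_top"
    using order_tendstoD(1)[OF cdf_lim_at_top_prob p(2)] .
  then obtain b where b: "p < cdf M b" by (auto simp: eventually_at_top_linorder)
  have "a \<le> b" using a b cdf_nondecreasing[of b a] by linarith
  then have "\<exists>q. a \<le> q \<and> q \<le> b \<and> cdf M q = p"
    using a b cont by (intro IVT) auto
  then show ?thesis using that by auto
qed

text \<open>
  The function \<open>x \<mapsto> E (max x X)\<close> is convex.  If it coincided with an affine function at three points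
  \<open>a < b < e\<close>, equality in the convexity inequality would hold for \<open>max x t\<close> at almost every \<open>t\<close>;
  but \<open>x \<mapsto> max x t\<close> has a kink inside \<open>(a, e)\<close> whenever \<open>a < t < e\<close>, so \<open>(a, e)\<close> would be a null set.
  For an atomless law the three points can be chosen around the quartiles, and then \<open>(a, e)\<close> has
  probability at least one half.
\<close>

lemma integral_max_not_affine:
  assumes int: "integrable M (\<lambda>t. t)" and atomless: "\<And>x. measure M {x} = 0"
  shows "\<not> (AE x in M. (\<integral>t. max x t \<partial>M) - d * x = c)"
proof
  assume AE: "AE x in M. (\<integral>t. max x t \<partial>M) - d * x = c"
  obtain q1 where q1: "cdf M q1 = 1/4" using cdf_attains[OF atomless, of "1/4"] by auto
  obtain q3 where q3: "cdf M q3 = 3/4" using cdf_attains[OF atomless, of "3/4"] by auto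
  have less: "q1 < q3" using q1 q3 cdf_nondecreasing[of q3 q1] by (cases "q1 < q3") auto
  have m1: "measure M {..q1} = 1/4" using q1 by (simp add: cdf_def)
  have m2: "measure M {q1<..q3} = 1/2" using cdf_diff_eq[OF less] q1 q3 by simp
  have m3: "measure M {q3<..} = 1/4"
  proof -
    have "measure M (space M - {..q3}) = 1 - measure M {..q3}" by (rule prob_compl) simp
    moreover have "space M - {..q3} = {q3<..}" by auto
    ultimately show ?thesis using q3 by (simp add: cdf_def)
  qed
  obtain a where a: "a \<le> q1" "(\<integral>t. max a t \<partial>M) - d * a = c"
    using AE_imp_ex_in_pos_measure[OF AE, of "{..q1}"] m1 by auto
  obtain b where b: "q1 < b" "b \<le> q3" "(\<integral>t. max b t \<partial>M) - d * b = c"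
    using AE_imp_ex_in_pos_measure[OF AE, of "{q1<..q3}"] m2 by auto
  obtain e where e: "q3 < e" "(\<integral>t. max e t \<partial>M) - d * e = c"
    using AE_imp_ex_in_pos_measure[OF AE, of "{q3<..}"] m3 by auto
  \<comment> \<open>The convexity defect of \<open>x \<mapsto> max x t\<close> at \<open>a < b < e\<close>, cleared of denominators.\<close>
  define D where "D t = (e - b) * max a t + (b - a) * max e t - (e - a) * max b t" for t :: real
  have ineq: "0 \<le> D t" "a < t \<Longrightarrow> t < e \<Longrightarrow> 0 < D t" for t
  proof -
    consider "t \<le> a" | "a < t" "t < b" | "b \<le> t" "t < e" | "e \<le> t" by linarith
    then have "0 \<le> D t \<and> (a < t \<and> t < e \<longrightarrow> 0 < D t)"
    proof cases
      case 1
      then have "D t = 0" using a b e by (simp add: D_def max_def algebra_simps)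
      then show ?thesis using 1 by simp
    next
      case 2
      then have "D t = (e - b) * (t - a)" using a b e by (simp add: D_def max_def algebra_simps)
      then show ?thesis using 2 a b e by simp
    next
      case 3
      then have "D t = (b - a) * (e - t)" using a b e by (simp add: D_def max_def algebra_simps)
      then show ?thesis using 3 a b e by simp
    next
      case 4
      then have "D t = 0" using a b e by (simp add: D_def max_def algebra_simps)
      then show ?thesis using 4 by simp
    qed
    then show "0 \<le> D t" "a < t \<Longrightarrow> t < e \<Longrightarrow> 0 < D t" by auto
  qed
  have intD: "integrable M D"
    unfolding D_def using int by (intro Bochner_Integration.integrable_add
        Bochner_Integration.integrable_diff integrable_mult_right integrable_max_const)
  have "(\<integral>t. D t \<partial>M) = (e - b) * (\<integral>t. max a t \<partial>M) + (b - a) * (\<integral>t. max e t \<partial>M)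
      - (e - a) * (\<integral>t. max b t \<partial>M)"
    unfolding D_def using integrable_max_const[OF int]
    by simp
  also have "\<dots> = (e - b) * (c + d * a) + (b - a) * (c + d * e) - (e - a) * (c + d * b)"
  proof -
    have "(\<integral>t. max a t \<partial>M) = c + d * a" "(\<integral>t. max e t \<partial>M) = c + d * e" "(\<integral>t. max b t \<partial>M) = c + d * b"
      using a b e by linarith+
    then show ?thesis by simp
  qed
  also have "\<dots> = 0" by (simp add: algebra_simps)
  finally have "AE t in M. D t = 0"
    using integral_nonneg_eq_0_iff_AE[OF intD] ineq(1) by simp
  then obtain t where "t \<in> {q1<..q3}" "D t = 0"
    using AE_imp_ex_in_pos_measure[of "\<lambda>t. D t = 0" "{q1<..q3}"] m2 by auto
  then show False using ineq(2)[of t] a e by auto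
qed

lemma integrable_pair_fst_snd:
  assumes int: "integrable M f"
  shows "integrable (M \<Otimes>\<^sub>M M) (\<lambda>z. f (fst z))" "integrable (M \<Otimes>\<^sub>M M) (\<lambda>z. f (snd z) :: real)"
    "(\<integral>z. f (fst z) \<partial>(M \<Otimes>\<^sub>M M)) = (\<integral>x. f x \<partial>M)" "(\<integral>z. f (snd z) \<partial>(M \<Otimes>\<^sub>M M)) = (\<integral>x. f x \<partial>M)"
proof -
  have fst: "distr (M \<Otimes>\<^sub>M M) M fst = M" by (rule distr_pair_fst)
  interpret pair_prob_space M M ..
  have [measurable]: "f \<in> borel_measurable M" using int by simp
  have "distr (M \<Otimes>\<^sub>M M) M snd = distr (distr (M \<Otimes>\<^sub>M M) (M \<Otimes>\<^sub>M M) (\<lambda>(x, y). (y, x))) M snd"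
    using distr_pair_swap by simp
  also have "\<dots> = distr (M \<Otimes>\<^sub>M M) M fst"
    by (subst distr_distr) (simp_all add: comp_def case_prod_beta)
  finally have snd: "distr (M \<Otimes>\<^sub>M M) M snd = M" using fst by simp
  show "integrable (M \<Otimes>\<^sub>M M) (\<lambda>z. f (fst z))"
    using integrable_distr_eq[of fst "M \<Otimes>\<^sub>M M" M f] int unfolding fst by simp
  show "integrable (M \<Otimes>\<^sub>M M) (\<lambda>z. f (snd z))"
    using integrable_distr_eq[of snd "M \<Otimes>\<^sub>M M" M f] int unfolding snd by simp
  show "(\<integral>z. f (fst z) \<partial>(M \<Otimes>\<^sub>M M)) = (\<integral>x. f x \<partial>M)"
    using integral_distr[of fst "M \<Otimes>\<^sub>M M" M f] unfolding fst by simp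
  show "(\<integral>z. f (snd z) \<partial>(M \<Otimes>\<^sub>M M)) = (\<integral>x. f x \<partial>M)"
    using integral_distr[of snd "M \<Otimes>\<^sub>M M" M f] unfolding snd by simp
qed

text \<open>
  The gap between the two sides is \<open>E (min Z\<^sub>1 Z\<^sub>2)\<close> after writing the sum as maximum plus minimum, and a
  positive variable has positive mean.
\<close>

lemma mean_max_less_twice_mean:
  assumes int: "integrable M (\<lambda>t. t)" and pos: "AE t in M. 0 < t"
  shows "(\<integral>z. max (fst z) (snd z) \<partial>(M \<Otimes>\<^sub>M M)) < 2 * (\<integral>t. t \<partial>M)"
proof -
  interpret pair_prob_space M M ..
  note i = integrable_pair_fst_snd[OF int]
  have intmax: "integrable (M \<Otimes>\<^sub>M M) (\<lambda>z. max (fst z) (snd z))"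
    and intmin: "integrable (M \<Otimes>\<^sub>M M) (\<lambda>z. min (fst z) (snd z))"
    using i(1,2) by auto
  have pos2: "AE z in M \<Otimes>\<^sub>M M. 0 < min (fst z) (snd z)"
  proof (rule AE_pair_measure)
    have "{z \<in> space (M \<Otimes>\<^sub>M M). 0 < min (fst z) (snd z)} \<in> sets (M \<Otimes>\<^sub>M M)"
      using intmin by measurable
    then show "{z \<in> space (M \<Otimes>\<^sub>M M). 0 < min (fst z) (snd z)} \<in> sets (M \<Otimes>\<^sub>M M)" .
    show "AE x in M. AE y in M. 0 < min (fst (x, y)) (snd (x, y))"
      using pos
    proof eventually_elim
      case (elim x)
      from pos show ?case by eventually_elim (use elim in simp)
    qed
  qed
  have eq: "min (fst z) (snd z) = fst z + snd z - max (fst z) (snd z)" for z :: "real \<times> real"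
    by (auto simp: min_def max_def)
  have "0 < (\<integral>z. min (fst z) (snd z) \<partial>(M \<Otimes>\<^sub>M M))"
  proof (rule ccontr)
    assume "\<not> 0 < (\<integral>z. min (fst z) (snd z) \<partial>(M \<Otimes>\<^sub>M M))"
    moreover have "0 \<le> (\<integral>z. min (fst z) (snd z) \<partial>(M \<Otimes>\<^sub>M M))"
      by (rule integral_nonneg_AE) (use pos2 in \<open>eventually_elim, simp\<close>)
    ultimately have "(\<integral>z. min (fst z) (snd z) \<partial>(M \<Otimes>\<^sub>M M)) = 0" by simp
    then have "AE z in M \<Otimes>\<^sub>M M. min (fst z) (snd z) = 0"
      by (subst (asm) integral_nonneg_eq_0_iff_AE[OF intmin]) (use pos2 in \<open>auto elim: eventually_mono\<close>)
    with pos2 have "AE z in M \<Otimes>\<^sub>M M. False" by eventually_elim simp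
    then show False by (simp add: AE_False)
  qed
  also have "(\<integral>z. min (fst z) (snd z) \<partial>(M \<Otimes>\<^sub>M M))
      = 2 * (\<integral>t. t \<partial>M) - (\<integral>z. max (fst z) (snd z) \<partial>(M \<Otimes>\<^sub>M M))"
    unfolding eq using i intmax by simp
  finally show ?thesis by simp
qed

text \<open>
  By Fubini some section \<open>y \<mapsto> max x y - d (x + y)\<close> is square integrable, and \<open>(1 - d) y\<close> exceeds its
  absolute value by at most the constant \<open>x\<close>.
\<close>

lemma square_integrable_from_kernel:
  assumes nonneg: "AE t in M. 0 \<le> t" and d: "0 \<le> d" "d < 1"
    and sq: "integrable (M \<Otimes>\<^sub>M M) (\<lambda>z. (max (fst z) (snd z) - d * (fst z + snd z))\<^sup>2)"
  shows "integrable M (\<lambda>t. t\<^sup>2)"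
proof -
  have UNIV: "measure M UNIV \<noteq> 0" using prob_space by simp
  interpret pair_prob_space M M ..
  have "AE x in M. integrable M (\<lambda>y. (max x y - d * (x + y))\<^sup>2)"
    using AE_integrable_fst'[OF sq] by simp
  with nonneg have AE: "AE x in M. 0 \<le> x \<and> integrable M (\<lambda>y. (max x y - d * (x + y))\<^sup>2)"
    by eventually_elim simp
  obtain x where x: "0 \<le> x" "integrable M (\<lambda>y. (max x y - d * (x + y))\<^sup>2)"
    by (rule AE_imp_ex_in_pos_measure[OF AE _ UNIV]) auto
  let ?B = "\<lambda>y. 2 * (x\<^sup>2 + (max x y - d * (x + y))\<^sup>2) / (1 - d)\<^sup>2"
  show ?thesis
  proof (rule Bochner_Integration.integrable_bound)
    show "integrable M ?B" using x(2) by simp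
    have bound: "y\<^sup>2 \<le> ?B y" if y: "0 \<le> y" for y
    proof -
      have "(1 - d) * y \<le> x + \<bar>max x y - d * (x + y)\<bar>"
      proof (cases "y \<le> x")
        case True
        have "(1 - d) * y \<le> 1 * y" using d y by (intro mult_right_mono) auto
        then show ?thesis using True by simp
      next
        case False
        have "d * x \<le> 1 * x" using d x by (intro mult_right_mono) auto
        then show ?thesis using False by (simp add: max_def algebra_simps)
      qed
      then have "((1 - d) * y)\<^sup>2 \<le> (x + \<bar>max x y - d * (x + y)\<bar>)\<^sup>2"
        using d y by (intro power_mono) auto
      also have "\<dots> \<le> 2 * (x\<^sup>2 + (max x y - d * (x + y))\<^sup>2)"
        using sum_squares_bound[of x "\<bar>max x y - d * (x + y)\<bar>"] by (simp add: power2_sum)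
      finally show ?thesis using d by (simp add: pos_le_divide_eq power_mult_distrib mult.commute)
    qed
    show "AE y in M. norm (y\<^sup>2) \<le> norm (?B y)"
      using nonneg
    proof eventually_elim
      case (elim y)
      then show ?case using bound[OF elim] by simp
    qed
  qed simp
qed

end

lemma asym_var_eq:
  assumes N: "real_distribution (interval_measure H)" and H: "cdf (interval_measure H) = H"
    and int: "integrable (interval_measure H) (\<lambda>z. z)"
  shows "asym_var H = 4 / (mean_df H)\<^sup>2 * prob_space.variance (interval_measure H)
    (\<lambda>x. (\<integral>t. max x t \<partial>interval_measure H) - delta_df H / 2 * x)"
proof -
  interpret real_distribution "interval_measure H" by fact
  show ?thesis
    unfolding asym_var_def using cdf_plus_upper_tail_integral[OF int] unfolding H by simp
qed

section \<open>Star equivalence and scale families\<close>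

text \<open>
  The star order without inverse functions.  Taking \<open>y\<close> up to, and \<open>z\<close> down to, the quantiles of \<open>G\<close>
  at the levels \<open>F x\<close> and \<open>F x'\<close> recovers the monotone ratio; as \<open>y\<close> and \<open>z\<close> are real, infinite
  values of the inverse need no separate treatment.
\<close>

lemma star_leD:
  assumes star: "F \<le>\<^sub>* G" and G: "mono G"
    and x: "0 < x" "x \<le> x'" and y: "G y \<le> F x" and z: "F x' < G z"
  shows "y * x' \<le> z * x"
proof -
  have "ereal y / ereal x \<le> right_inv_df G (F x) / ereal x"
    unfolding right_inv_df_def using y x by (intro ereal_divide_right_mono Sup_upper) auto
  also have "\<dots> \<le> right_inv_df G (F x') / ereal x'"
    using mono_onD[OF star[unfolded star_le_def], of x x'] x by simp
  also have "\<dots> \<le> ereal z / ereal x'"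
  proof (rule ereal_divide_right_mono)
    show "right_inv_df G (F x') \<le> ereal z"
      unfolding right_inv_df_def
    proof (rule Sup_least)
      fix e assume "e \<in> ereal ` {w. G w \<le> F x'}"
      then obtain w where w: "e = ereal w" "G w \<le> F x'" by auto
      have "w \<le> z" using w z monoD[OF G, of z w] by (cases "w \<le> z") auto
      then show "e \<le> ereal z" using w by simp
    qed
  qed (use x in simp)
  finally show ?thesis using x by (simp add: field_simps)
qed

text \<open>
  The quantiles of \<open>F\<close> at the levels \<open>G y\<close> are at least \<open>x\<close> for all \<open>y > 0\<close>, so their ratio to \<open>y\<close> blows
  up as \<open>y\<close> tends to \<open>0\<close>, although it should be nondecreasing and is finite at \<open>q\<close>.
\<close>

lemma star_le_positive_lower_bound_False:
  assumes star: "G \<le>\<^sub>* F" and F: "mono F" "(F \<longlongrightarrow> 1) at_top"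
    and q: "0 < q" "G q < 1" and x: "0 < x" and le: "\<And>y. 0 < y \<Longrightarrow> F x \<le> G y"
  shows False
proof -
  have "eventually (\<lambda>z. G q < F z) at_top" using order_tendstoD(1)[OF F(2) q(2)] .
  then obtain z where z: "G q < F z" by (auto simp: eventually_at_top_linorder)
  have *: "x * q \<le> z * y" if "0 < y" "y \<le> q" for y
    by (rule star_leD[OF star F(1)]) (use that le z in auto)
  define y where "y = min q (x * q / (2 * (\<bar>z\<bar> + 1)))"
  have y: "0 < y" "y \<le> q" "y \<le> x * q / (2 * (\<bar>z\<bar> + 1))" using x q by (auto simp: y_def)
  have "z * y \<le> (\<bar>z\<bar> + 1) * y" using y by (intro mult_right_mono) auto
  also have "\<dots> \<le> (\<bar>z\<bar> + 1) * (x * q / (2 * (\<bar>z\<bar> + 1)))" using y by (intro mult_left_mono) auto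
  also have "\<dots> = x * q / 2" by (simp add: field_simps)
  also have "\<dots> < x * q" using x q by simp
  finally show False using *[OF y(1,2)] by simp
qed

lemma quantile_exists:
  fixes G :: "real \<Rightarrow> real"
  assumes G: "mono G" "(G \<longlongrightarrow> 1) at_top" and z: "G z0 \<le> u" and u: "u < 1"
  obtains c where "z0 \<le> c" "\<And>y. y < c \<Longrightarrow> G y \<le> u" "\<And>y. c < y \<Longrightarrow> u < G y"
proof
  let ?A = "{y. G y \<le> u}"
  have "eventually (\<lambda>z. u < G z) at_top" using order_tendstoD(1)[OF G(2) u] .
  then obtain w where w: "u < G w" by (auto simp: eventually_at_top_linorder)
  have "y \<le> w" if "y \<in> ?A" for y
    using that w monoD[OF G(1), of w y] by (cases "y \<le> w") auto
  then have bdd: "bdd_above ?A" by (rule bdd_aboveI)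
  show "z0 \<le> Sup ?A" using z bdd by (intro cSup_upper) auto
  show "G y \<le> u" if lt: "y < Sup ?A" for y
  proof -
    have "?A \<noteq> {}" using z by auto
    then obtain v where "G v \<le> u" "y < v" using less_cSupE[OF lt] by blast
    then show ?thesis using monoD[OF G(1), of y v] by linarith
  qed
  show "u < G y" if "Sup ?A < y" for y
    using cSup_upper[OF _ bdd, of y] that by (cases "u < G y") auto
qed

lemma at_right_0_le:
  fixes f g :: "real \<Rightarrow> real"
  assumes f: "isCont f 0" and g: "isCont g 0" and d: "0 < d"
    and le: "\<And>t. 0 < t \<Longrightarrow> t < d \<Longrightarrow> f t \<le> g t"
  shows "f 0 \<le> g 0"
proof (rule tendsto_le)
  show "(g \<longlongrightarrow> g 0) (at_right 0)" "(f \<longlongrightarrow> f 0) (at_right 0)"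
    using f g by (auto simp: isCont_def filterlim_at_split)
  show "eventually (\<lambda>t. f t \<le> g t) (at_right 0)"
    using eventually_at_right_less[of 0] eventually_at_right_real[OF d]
    by eventually_elim (use le in auto)
qed simp

text \<open>
  On a flat piece of \<open>F\<close> below level 1, the quantile of \<open>G\<close> at the level \<open>F x\<close> is a constant \<open>c\<close>, and
  \<open>c / x\<close> decreases unless \<open>c\<close> vanishes.  That \<open>c\<close> is positive comes from the star inequality in the
  opposite direction.
\<close>

lemma star_eq_strictly_increasing:
  assumes star: "F =\<^sub>* G" and F: "mono F" "(F \<longlongrightarrow> 1) at_top"
    and G: "mono G" "(G \<longlongrightarrow> 1) at_top" and q: "0 < q" "G q < 1"
    and x: "0 < x1" "x1 < x2" and lt1: "F x1 < 1"
  shows "F x1 < F x2"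
proof (rule ccontr)
  assume "\<not> F x1 < F x2"
  then have eq: "F x1 = F x2" using monoD[OF F(1), of x1 x2] x by simp
  have FG: "F \<le>\<^sub>* G" and GF: "G \<le>\<^sub>* F" using star by (auto simp: star_eq_def)
  show False
  proof (cases "\<exists>z>0. G z \<le> F x1")
    case False
    then show False
      using star_le_positive_lower_bound_False[OF GF F q, of x1] x by (meson less_imp_le not_le)
  next
    case True
    then obtain z0 where z0: "0 < z0" "G z0 \<le> F x1" by blast
    obtain c where c: "z0 \<le> c" "\<And>y. y < c \<Longrightarrow> G y \<le> F x1" "\<And>y. c < y \<Longrightarrow> F x1 < G y"
      using quantile_exists[OF G z0(2) lt1] by blast
    have "(c - 0) * x2 \<le> (c + 0) * x1"
    proof (rule at_right_0_le[where d = 1])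
      fix t :: real assume "0 < t"
      then show "(c - t) * x2 \<le> (c + t) * x1"
        using c eq x by (intro star_leD[OF FG G(1)]) auto
    qed (auto intro!: continuous_intros)
    then show False using c z0 x by auto
  qed
qed

text \<open>
  Let \<open>c x\<close> be the quantile of \<open>G\<close> at the level \<open>F x\<close>.  The inequality \<open>F \<le>\<^sub>* G\<close> says that \<open>c x / x\<close> is
  nondecreasing; since \<open>F\<close> is strictly increasing, \<open>x\<close> is also the quantile of \<open>F\<close> at that level, and
  \<open>G \<le>\<^sub>* F\<close> says that \<open>x / c x\<close> is nondecreasing.  Hence \<open>c x = a * x\<close>.  Continuity of \<open>F\<close> and right
  continuity of \<open>G\<close> then give \<open>G (a * x) = F x\<close>, even though \<open>G\<close> may a priori have atoms.
\<close>

lemma star_eq_imp_scale_family: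
  assumes star: "F =\<^sub>* G"
    and F: "mono F" "(F \<longlongrightarrow> 1) at_top" "\<And>x. isCont F x" "\<And>x. x \<le> 0 \<Longrightarrow> F x = 0" "\<And>x. F x \<le> 1"
    and G: "mono G" "(G \<longlongrightarrow> 1) at_top" "\<And>x. continuous (at_right x) G" "\<And>x. x < 0 \<Longrightarrow> G x = 0"
      "\<And>x. G x \<le> 1"
    and q: "0 < q" "G q < 1"
  obtains a where "0 < a" "\<And>x. F x = G (a * x)"
proof -
  have FG: "F \<le>\<^sub>* G" and GF: "G \<le>\<^sub>* F" using star by (auto simp: star_eq_def)
  have G0: "0 \<le> G x" for x using G(4)[of "min x 0 - 1"] monoD[OF G(1), of "min x 0 - 1" x] by simp
  have F0: "0 \<le> F x" for x using F(4)[of "min x 0"] monoD[OF F(1), of "min x 0" x] by simp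
  have "\<exists>c>0. (\<forall>y<c. G y \<le> F x) \<and> (\<forall>y>c. F x < G y)" if x: "0 < x" "F x < 1" for x
  proof -
    have "\<exists>z>0. G z \<le> F x"
      using star_le_positive_lower_bound_False[OF GF F(1,2) q x(1)] by (meson less_imp_le not_le)
    then obtain z0 where z0: "0 < z0" "G z0 \<le> F x" by blast
    show ?thesis
      using quantile_exists[OF G(1,2) z0(2) x(2)] z0(1) by (metis less_le_trans)
  qed
  then obtain c where c: "\<And>x. 0 < x \<Longrightarrow> F x < 1 \<Longrightarrow> 0 < c x"
    "\<And>x y. 0 < x \<Longrightarrow> F x < 1 \<Longrightarrow> y < c x \<Longrightarrow> G y \<le> F x"
    "\<And>x y. 0 < x \<Longrightarrow> F x < 1 \<Longrightarrow> c x < y \<Longrightarrow> F x < G y"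
    by metis
  have up: "c x1 * x2 \<le> c x2 * x1" if x: "0 < x1" "x1 < x2" "F x2 < 1" for x1 x2
  proof -
    have F1: "F x1 < 1" using monoD[OF F(1), of x1 x2] x by simp
    have "(c x1 - 0) * x2 \<le> (c x2 + 0) * x1"
    proof (rule at_right_0_le[where d = 1])
      fix t :: real assume "0 < t"
      then show "(c x1 - t) * x2 \<le> (c x2 + t) * x1"
        using c F1 x by (intro star_leD[OF FG G(1)]) auto
    qed (auto intro!: continuous_intros)
    then show ?thesis by simp
  qed
  have ratio: "c x1 * x2 = c x2 * x1" if x: "0 < x1" "x1 < x2" "F x2 < 1" for x1 x2
  proof -
    have F1: "F x1 < 1" using monoD[OF F(1), of x1 x2] x by simp
    have "c x1 * x1 < c x1 * x2" using x c(1)[OF x(1) F1] by simp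
    also have "\<dots> \<le> c x2 * x1" by (rule up[OF x])
    finally have less: "c x1 < c x2" using x by simp
    have "x1 * (c x2 - 0) \<le> (x2 + 0) * (c x1 + 0)"
    proof (rule at_right_0_le[where d = "(c x2 - c x1) / 2"])
      fix t :: real assume t: "0 < t" "t < (c x2 - c x1) / 2"
      show "x1 * (c x2 - t) \<le> (x2 + t) * (c x1 + t)"
      proof (rule star_leD[OF GF F(1)])
        show "0 < c x1 + t" using c(1)[OF x(1) F1] t by simp
        show "c x1 + t \<le> c x2 - t" using t by simp
        show "F x1 \<le> G (c x1 + t)" using c(3)[OF x(1) F1, of "c x1 + t"] t by simp
        have "G (c x2 - t) \<le> F x2" using c(2)[of x2 "c x2 - t"] x t by simp
        also have "\<dots> < F (x2 + t)"
          using star_eq_strictly_increasing[OF star F(1,2) G(1,2) q, of x2 "x2 + t"] x t by simp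
        finally show "G (c x2 - t) < F (x2 + t)" .
      qed
    qed (use less in \<open>auto intro!: continuous_intros\<close>)
    then show ?thesis using up[OF x] by (simp add: mult.commute)
  qed
  have "(F \<longlongrightarrow> F 0) (nhds 0)"
    using F(3)[of 0] unfolding isCont_def tendsto_at_iff_tendsto_nhds .
  then have "eventually (\<lambda>x. F x < 1) (nhds 0)"
    using F(4)[of 0] by (intro order_tendstoD(2)) auto
  then obtain e where e: "0 < e" "\<And>x. dist x 0 < e \<Longrightarrow> F x < 1"
    by (auto simp: eventually_nhds_metric)
  define p where "p = e / 2"
  have p: "0 < p" "F p < 1" using e by (auto simp: p_def)
  define a where "a = c p / p"
  have a: "0 < a" using c(1)[OF p] p by (simp add: a_def)
  have c_eq: "c x = a * x" if x: "0 < x" "F x < 1" for x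
    using ratio[of x p] ratio[of p x] p x by (cases x p rule: linorder_cases) (auto simp: a_def field_simps)
  have mid: "F x = G (a * x)" if x: "0 < x" "F x < 1" for x
  proof (rule antisym)
    show "F x \<le> G (a * x)"
    proof (rule tendsto_lowerbound)
      show "(G \<longlongrightarrow> G (a * x)) (at_right (a * x))" using G(3) by (simp add: continuous_within)
      show "eventually (\<lambda>y. F x \<le> G y) (at_right (a * x))"
        using eventually_at_right_less[of "a * x"]
        by eventually_elim (use c(3)[OF x] c_eq[OF x] in \<open>auto intro: less_imp_le\<close>)
    qed simp
    show "G (a * x) \<le> F x"
    proof (rule tendsto_lowerbound)
      show "(F \<longlongrightarrow> F x) (at_right x)" using F(3)[of x] by (auto simp: isCont_def filterlim_at_split)
      then have "eventually (\<lambda>y. F y < 1) (at_right x)" using x by (intro order_tendstoD(2)) auto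
      then show "eventually (\<lambda>y. G (a * x) \<le> F y) (at_right x)"
        using eventually_at_right_less[of x]
        by eventually_elim (use c(2) c_eq x a in \<open>auto intro!: c(2)\<close>)
    qed simp
  qed
  have "F x = G (a * x)" for x
  proof -
    consider "x < 0" | "x = 0" | "0 < x" "F x < 1" | "0 < x" "F x = 1"
      using F(5)[of x] by fastforce
    then show ?thesis
    proof cases
      case 1
      then show ?thesis using F(4) G(4) a by (simp add: mult_pos_neg)
    next
      case 2
      have "G 0 \<le> 0"
      proof (rule tendsto_lowerbound)
        show "(F \<longlongrightarrow> 0) (at_right 0)" using F(3)[of 0] F(4)[of 0] by (auto simp: isCont_def filterlim_at_split)
        then have "eventually (\<lambda>y. F y < 1) (at_right 0)" by (intro order_tendstoD(2)) auto
        then show "eventually (\<lambda>y. G 0 \<le> F y) (at_right 0)"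
          using eventually_at_right_less[of 0]
        proof eventually_elim
          case (elim y)
          then show ?case using mid[of y] monoD[OF G(1), of 0 "a * y"] a by simp
        qed
      qed simp
      then show ?thesis using 2 F(4) G0[of 0] by simp
    next
      case 3
      then show ?thesis by (rule mid)
    next
      case 4
      have "1 \<le> G (a * x)"
      proof (rule field_le_epsilon)
        fix \<epsilon> :: real assume \<epsilon>: "0 < \<epsilon>"
        \<comment> \<open>A level below 1, kept positive so that the point where \<open>F\<close> attains it is not \<open>0\<close>.\<close>
        define u where "u = max (1 - \<epsilon>) (1/2)"
        have u: "0 < u" "u < 1" "1 - \<epsilon> \<le> u" using \<epsilon> by (auto simp: u_def)
        have "\<exists>v. 0 \<le> v \<and> v \<le> x \<and> F v = u"
          using 4 u F(3) F(4)[of 0] by (intro IVT) auto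
        then obtain v where v: "0 \<le> v" "v \<le> x" "F v = u" by blast
        have "v \<noteq> 0" using v u F(4)[of 0] by auto
        then have "G (a * v) = u" using mid[of v] v u by simp
        moreover have "G (a * v) \<le> G (a * x)" using v a by (intro monoD[OF G(1)]) simp
        ultimately show "1 \<le> G (a * x) + \<epsilon>" using u by simp
      qed
      then show ?thesis using 4 G(5)[of "a * x"] by simp
    qed
  qed
  with a that show thesis by blast
qed

lemma interval_measure_scale:
  assumes N: "real_distribution (interval_measure F)" "cdf (interval_measure F) = F"
    and L: "real_distribution (interval_measure G)" "cdf (interval_measure G) = G"
    and a: "0 < a" and eq: "\<And>x. F x = G (a * x)"
  shows "interval_measure G = distr (interval_measure F) borel ((*) a)"
proof (rule cdf_unique)
  interpret real_distribution "interval_measure F" by fact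
  show "real_distribution (interval_measure G)" by fact
  show "real_distribution (distr (interval_measure F) borel ((*) a))" by simp
  show "cdf (interval_measure G) = cdf (distr (interval_measure F) borel ((*) a))"
  proof
    fix x
    have "(*) a -` {..x} = {..x / a}" using a by (auto simp: field_simps)
    then have "cdf (distr (interval_measure F) borel ((*) a)) x = cdf (interval_measure F) (x / a)"
      by (simp add: cdf_def measure_distr)
    then show "cdf (interval_measure G) x = cdf (distr (interval_measure F) borel ((*) a)) x"
      using N L eq[of "x / a"] a by simp
  qed
qed

lemma scale_invariance:
  assumes N: "real_distribution (interval_measure F)" "cdf (interval_measure F) = F"
    and L: "real_distribution (interval_measure G)" "cdf (interval_measure G) = G"
    and intF: "integrable (interval_measure F) (\<lambda>z. z)" and intG: "integrable (interval_measure G) (\<lambda>z. z)"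
    and a: "0 < a" and eq: "\<And>x. F x = G (a * x)"
  shows "delta_df G = delta_df F" "asym_var G = asym_var F"
proof -
  interpret real_distribution "interval_measure F" by fact
  let ?F = "interval_measure F" and ?G = "interval_measure G"
  interpret P: pair_prob_space ?F ?F ..
  interpret G: prob_space "distr ?F borel ((*) a)" by (rule prob_space_distr) simp
  have G: "?G = distr ?F borel ((*) a)" by (rule interval_measure_scale[OF N L a eq])
  have max: "max (a * x) (a * t) = a * max x t" for x t using a by (simp add: max_mult_distrib_left)
  have mean: "mean_df G = a * mean_df F"
    unfolding mean_df_def G by (subst integral_distr) auto
  have GG: "?G \<Otimes>\<^sub>M ?G = distr (?F \<Otimes>\<^sub>M ?F) (borel \<Otimes>\<^sub>M borel) (\<lambda>(x, y). (a * x, a * y))"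
    unfolding G by (rule pair_measure_distr) (auto intro: G.sigma_finite_measure)
  have mmax: "mean_max_df G = a * mean_max_df F"
    unfolding mean_max_df_def GG by (subst integral_distr) (auto simp: case_prod_beta max)
  show delta: "delta_df G = delta_df F"
    using a by (simp add: delta_df_def mean mmax)
  let ?k = "\<lambda>x. (\<integral>t. max x t \<partial>?F) - delta_df F / 2 * x"
  have k [measurable]: "?k \<in> borel_measurable ?F" by simp
  have kG: "(\<integral>t. max (a * x) t \<partial>?G) - delta_df G / 2 * (a * x) = a * ?k x" for x
    unfolding G delta by (subst integral_distr) (simp_all add: max right_diff_distrib)
  have lift: "(\<integral>y. h y \<partial>?G) = (\<integral>x. h (a * x) \<partial>?F)" if "h \<in> borel_measurable borel" for h :: "real \<Rightarrow> real"
    unfolding G using that by (subst integral_distr) auto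
  interpret L: real_distribution ?G by fact
  have "asym_var G = 4 / (a * mean_df F)\<^sup>2 * (a\<^sup>2 * variance ?k)"
  proof -
    let ?kG = "\<lambda>y. (\<integral>t. max y t \<partial>?G) - delta_df G / 2 * y"
    have kGm [measurable]: "?kG \<in> borel_measurable borel" by measurable
    have E: "(\<integral>y. ?kG y \<partial>?G) = a * (\<integral>x. ?k x \<partial>?F)"
      by (subst lift[OF kGm]) (simp only: kG integral_mult_right_zero)
    have "(\<integral>y. (?kG y - a * (\<integral>x. ?k x \<partial>?F))\<^sup>2 \<partial>?G) = (\<integral>x. (a * ?k x - a * (\<integral>x. ?k x \<partial>?F))\<^sup>2 \<partial>?F)"
      by (subst lift) (simp_all only: kG, measurable)
    also have "\<dots> = (\<integral>x. a\<^sup>2 * (?k x - (\<integral>x. ?k x \<partial>?F))\<^sup>2 \<partial>?F)"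
      by (simp only: right_diff_distrib[symmetric] power_mult_distrib)
    also have "\<dots> = a\<^sup>2 * variance ?k" by (rule integral_mult_right_zero)
    finally show ?thesis
      unfolding asym_var_eq[OF L intG] E mean by simp
  qed
  also have "\<dots> = asym_var F"
    unfolding asym_var_eq[OF N intF] using a by (simp add: power_mult_distrib)
  finally show "asym_var G = asym_var F" .
qed

text \<open>
  Reduces star equivalence of the two distribution functions to a change of scale.  The positive mean of
  \<open>G\<close> enters by excluding the point mass at \<open>0\<close>.
\<close>

lemma star_eq_imp_equal_functionals:
  assumes F: "nonneg_dist_fun F" "finite_pos_mean F" and dens: "has_density F"
    and G: "nonneg_dist_fun G" "finite_pos_mean G" and star: "F =\<^sub>* G"
  shows "delta_df G = delta_df F" "asym_var G = asym_var F"
proof -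
  note F' = nonneg_dist_funD[OF F(1)] and G' = nonneg_dist_funD[OF G(1)]
  interpret F: real_distribution "interval_measure F" by (rule F')
  interpret G: real_distribution "interval_measure G" by (rule G')
  note cF = F.cdf_nondecreasing F.cdf_lim_at_top_prob F.cdf_bounded_prob
  note cG = G.cdf_nondecreasing G.cdf_lim_at_top_prob G.cdf_bounded_prob G.cdf_is_right_cont
  have zero: "H x = 0" if H: "nonneg_dist_fun H" and x: "x < 0" for H x
  proof -
    note H' = nonneg_dist_funD[OF H]
    interpret H: real_distribution "interval_measure H" by (rule H')
    have "AE z in interval_measure H. z \<notin> {..x}" using H'(2) by eventually_elim (use x in simp)
    then have "{..x} \<in> null_sets (interval_measure H)" by (subst AE_iff_null_sets) auto
    then have "cdf (interval_measure H) x = 0" by (simp add: cdf_def measure_def null_sets_def)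
    then show ?thesis using H'(3) by simp
  qed
  have contF: "isCont F x" for x
    using F.isCont_cdf[of x] has_density_no_atoms[OF dens, of x] unfolding F'(3) by (simp add: measure_def)
  have zeroF: "F x = 0" if "x \<le> 0" for x
  proof (cases "x = 0")
    case True
    have "F 0 \<le> 0"
    proof (rule tendsto_upperbound)
      show "(F \<longlongrightarrow> F 0) (at_left 0)" using contF[of 0] by (auto simp: isCont_def filterlim_at_split)
      show "eventually (\<lambda>y. F y \<le> 0) (at_left 0)"
        unfolding eventually_at_filter using zero[OF F(1)] by simp
    qed simp
    then show ?thesis using F.cdf_nonneg[of 0] True unfolding F'(3) by simp
  qed (use that zero[OF F(1)] in simp)
  have "\<exists>q>0. G q < 1"
  proof (rule ccontr)
    assume "\<not> (\<exists>q>0. G q < 1)"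
    then have one: "G q = 1" if "0 < q" for q
      using that G.cdf_bounded_prob[of q] unfolding G'(3) by (meson antisym not_less)
    have "(G \<longlongrightarrow> G 0) (at_right 0)" using G.cdf_is_right_cont[of 0] unfolding G'(3) by (simp add: continuous_within)
    moreover have "(G \<longlongrightarrow> 1) (at_right 0)"
      by (rule tendsto_eventually) (use one in \<open>simp add: eventually_at_filter\<close>)
    ultimately have "G 0 = 1" using tendsto_unique[of "at_right (0::real)"] by simp
    then have "measure (interval_measure G) {..0} = 1" using G'(3) unfolding cdf_def by metis
    then have "AE z in interval_measure G. z \<in> {..0}" by (subst (asm) G.prob_eq_1) auto
    with G'(2) have "AE z in interval_measure G. z = 0" by eventually_elim simp
    then have "mean_df G = (\<integral>z. 0 \<partial>interval_measure G)"
      unfolding mean_df_def by (intro integral_cong_AE) auto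
    then show False using G(2) by (simp add: finite_pos_mean_def)
  qed
  then obtain q where q: "0 < q" "G q < 1" by blast
  obtain a where a: "0 < a" "\<And>x. F x = G (a * x)"
  proof (rule star_eq_imp_scale_family[OF star _ _ contF zeroF _ _ _ _ zero[OF G(1)] _ q])
    show "mono F" "mono G" using cF(1) cG(1) unfolding F'(3) G'(3) by (auto intro: monoI)
    show "(F \<longlongrightarrow> 1) at_top" "(G \<longlongrightarrow> 1) at_top" using cF(2) cG(2) unfolding F'(3) G'(3) by auto
    show "F x \<le> 1" "G x \<le> 1" for x using cF(3) cG(3) unfolding F'(3) G'(3) by auto
    show "continuous (at_right x) G" for x using cG(4) unfolding G'(3) by auto
    fix a assume "0 < a" "\<And>x. F x = G (a * x)"
    then show thesis by (rule that)
  qed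
  show "delta_df G = delta_df F" "asym_var G = asym_var F"
    by (rule scale_invariance[OF F'(1,3) G'(1,3) _ _ a];
        use F(2) G(2) in \<open>simp add: finite_pos_mean_def\<close>)+
qed

section \<open>The ratio estimator\<close>

lemma sum_offdiagonal_add:
  fixes u :: "nat \<Rightarrow> real"
  shows "(\<Sum>i=1..n. \<Sum>j\<in>{1..n}-{i}. u i + u j) = 2 * (real n - 1) * (\<Sum>i=1..n. u i)"
proof -
  have "(\<Sum>j\<in>{1..n}-{i}. u i + u j) = (real n - 2) * u i + (\<Sum>j=1..n. u j)" if i: "i \<in> {1..n}" for i
  proof -
    have "(\<Sum>j\<in>{1..n}-{i}. u j) = (\<Sum>j=1..n. u j) - u i" using i by (simp add: sum_diff1)
    moreover have "real (card ({1..n}-{i})) = real n - 1" using i by (simp add: of_nat_diff)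
    moreover have "(\<Sum>j\<in>{1..n}-{i}. u i + u j)
        = real (card ({1..n}-{i})) * u i + (\<Sum>j\<in>{1..n}-{i}. u j)"
      by (simp add: sum.distrib)
    ultimately show ?thesis by (simp only:) (simp add: left_diff_distrib)
  qed
  then have "(\<Sum>i=1..n. \<Sum>j\<in>{1..n}-{i}. u i + u j) = (\<Sum>i=1..n. (real n - 2) * u i + (\<Sum>j=1..n. u j))"
    by (rule sum.cong[OF refl])
  also have "\<dots> = (real n - 2) * (\<Sum>i=1..n. u i) + real n * (\<Sum>j=1..n. u j)"
    by (simp add: sum.distrib sum_distrib_left)
  finally show ?thesis by (simp add: algebra_simps)
qed

text \<open>
  The Hoeffding decomposition as an algebraic identity: subtracting \<open>2 d\<close> from the ratio replaces the
  kernel \<open>max\<close> by \<open>\<phi>(u, v) = max u v - d * (u + v)\<close>, whose one-variable parts \<open>h\<close> are collected in a single sum.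
\<close>

lemma delta_hat_decomposition:
  fixes x :: "nat \<Rightarrow> real" and h :: "real \<Rightarrow> real" and d :: real
  defines "g u v \<equiv> max u v - d * (u + v) - h u - h v"
  assumes n: "2 \<le> n" and m: "sample_mean n x \<noteq> 0"
  shows "delta_hat n x - 2 * d = ((\<Sum>i=1..n. \<Sum>j\<in>{1..n}-{i}. g (x i) (x j)) / (real n * (real n - 1))
      + 2 / real n * (\<Sum>i=1..n. h (x i))) / sample_mean n x"
proof -
  let ?S = "\<Sum>i=1..n. \<Sum>j\<in>{1..n}-{i}. g (x i) (x j)" and ?B = "\<Sum>i=1..n. h (x i)"
  have sx: "(\<Sum>i=1..n. x i) = real n * sample_mean n x" using n by (simp add: sample_mean_def)
  have "(\<Sum>i=1..n. \<Sum>j\<in>{1..n}-{i}. max (x i) (x j))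
      = (\<Sum>i=1..n. \<Sum>j\<in>{1..n}-{i}. g (x i) (x j) + ((d * x i + h (x i)) + (d * x j + h (x j))))"
    unfolding g_def by (intro sum.cong refl) (simp add: algebra_simps)
  also have "\<dots> = ?S + (\<Sum>i=1..n. \<Sum>j\<in>{1..n}-{i}. (d * x i + h (x i)) + (d * x j + h (x j)))"
    by (simp add: sum.distrib)
  also have "\<dots> = ?S + 2 * (real n - 1) * (\<Sum>i=1..n. d * x i + h (x i))"
    by (subst sum_offdiagonal_add[of "\<lambda>i. d * x i + h (x i)" n]) simp
  also have "(\<Sum>i=1..n. d * x i + h (x i)) = d * (real n * sample_mean n x) + ?B"
    by (simp only: sum.distrib sum_distrib_left[symmetric] sx)
  finally have eq: "(\<Sum>i=1..n. \<Sum>j\<in>{1..n}-{i}. max (x i) (x j))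
      = ?S + 2 * (real n - 1) * (d * (real n * sample_mean n x) + ?B)" .
  have "real n \<noteq> 0" "real n - 1 \<noteq> 0" using n by auto
  then show ?thesis
    unfolding delta_hat_def eq using m by (simp add: field_simps)
qed


text \<open>
  A Markov-type bound, stated pointwise so that taking expectations directly bounds the probability of a
  large linearization error.  It separates the event that the sample mean is at most \<open>\<mu> / 2\<close>, which is paid
  for by the last term as in Chebyshev's inequality, from its complement, where the error is \<open>2 / \<mu>\<^sup>2\<close> times at most
  \<open>\<bar>sqrt n * \<mu> * S / (n * (n - 1)) - 2 * B * C / (n * sqrt n)\<bar>\<close>.  The products are then bounded by
  squares, because only second moments of \<open>S\<close>, \<open>B\<close> and \<open>C\<close> are at hand.
\<close>

lemma delta_hat_linearization_bound:
  fixes x :: "nat \<Rightarrow> real" and h :: "real \<Rightarrow> real" and d \<mu> \<epsilon> :: real and n :: nat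
  defines "g u v \<equiv> max u v - d * (u + v) - h u - (h v :: real)"
  defines "S \<equiv> \<Sum>i=1..n. \<Sum>j\<in>{1..n}-{i}. g (x i) (x j)"
    and "B \<equiv> \<Sum>i=1..n. h (x i)" and "C \<equiv> \<Sum>i=1..n. x i - \<mu>"
  assumes n: "2 \<le> n" and \<mu>: "0 < \<mu>" and \<epsilon>: "0 < \<epsilon>"
    and large: "\<epsilon> < \<bar>sqrt n * (delta_hat n x - 2 * d) - 2 / \<mu> / sqrt n * B\<bar>"
  shows "1 \<le> 2 / (\<epsilon> * \<mu>\<^sup>2) * (1 / (2 * sqrt n) + sqrt n * n * \<mu>\<^sup>2 / (2 * (real n * (real n - 1))\<^sup>2) * (S)\<^sup>2
      + ((B)\<^sup>2 + (C)\<^sup>2) / (n * sqrt n)) + 4 / (n\<^sup>2 * \<mu>\<^sup>2) * (C)\<^sup>2"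
proof -
  let ?m = "sample_mean n x" and ?r = "sqrt (real n)" and ?N = "real n * (real n - 1)"
  define R where "R = 1 / (2 * ?r) + ?r * n * \<mu>\<^sup>2 / (2 * ?N\<^sup>2) * (S)\<^sup>2 + ((B)\<^sup>2 + (C)\<^sup>2) / (n * ?r)"
  have r: "0 < ?r" "?r * ?r = n" using n by auto
  have N: "0 < ?N" using n by simp
  have C: "C = n * (?m - \<mu>)"
    using n by (simp add: C_def sum_subtractf sample_mean_def algebra_simps)
  have R0: "0 \<le> R" using r n by (simp add: R_def)
  have "1 \<le> 2 / (\<epsilon> * \<mu>\<^sup>2) * R + 4 / (n\<^sup>2 * \<mu>\<^sup>2) * (C)\<^sup>2"
  proof (cases "?m \<le> \<mu> / 2")
    case True
    then have "\<mu> / 2 \<le> \<bar>?m - \<mu>\<bar>" using \<mu> by simp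
    then have "(\<mu> / 2)\<^sup>2 \<le> \<bar>?m - \<mu>\<bar>\<^sup>2" using \<mu> by (intro power_mono) auto
    then have "1 \<le> 4 / \<mu>\<^sup>2 * (?m - \<mu>)\<^sup>2" using \<mu> by (simp add: field_simps)
    also have "\<dots> = 4 / (n\<^sup>2 * \<mu>\<^sup>2) * (C)\<^sup>2" using n by (simp add: C power_mult_distrib)
    finally show ?thesis using R0 \<epsilon> \<mu> by (simp add: add_increasing)
  next
    case False
    then have m: "\<mu> / 2 < ?m" "0 < ?m" using \<mu> by auto
    define T where "T = ?r * (delta_hat n x - 2 * d) - 2 / \<mu> / ?r * B"
    define D where "D = delta_hat n x - 2 * d"
    have D: "?m * D = S / ?N + 2 / n * B"
      unfolding D_def S_def B_def g_def using delta_hat_decomposition[OF n, of x d h] m by simp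
    have "\<mu> * ?m * T = ?r * \<mu> * (?m * D) - 2 * ?m / ?r * B"
      unfolding T_def D_def[symmetric] using \<mu> r by (simp add: right_diff_distrib)
    also have "\<dots> = ?r * \<mu> * S / ?N + (?r * 2 / n * \<mu> - 2 * ?m / ?r) * B"
      unfolding D by (simp add: algebra_simps)
    also have "?r * 2 / n * \<mu> - 2 * ?m / ?r = - (2 * C / (n * ?r))"
    proof -
      have "?r / n = 1 / ?r" using r by (simp add: field_simps)
      moreover have "?r * 2 / n * \<mu> = 2 * \<mu> * (?r / n)" by simp
      ultimately have "?r * 2 / n * \<mu> = 2 * \<mu> / ?r" by simp
      moreover have "2 * C / (n * ?r) = 2 * (?m - \<mu>) / ?r" using n by (simp add: C)
      ultimately show ?thesis by (simp add: diff_divide_distrib right_diff_distrib)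
    qed
    finally have T: "\<mu> * ?m * T = ?r * \<mu> * S / ?N - 2 * (B * C) / (n * ?r)"
      by (simp add: field_simps)
    have b1: "\<bar>?r * \<mu> * S / ?N\<bar> \<le> 1 / (2 * ?r) + ?r * n * \<mu>\<^sup>2 / (2 * ?N\<^sup>2) * (S)\<^sup>2"
    proof -
      define a where "a = \<mu> * S / ?N"
      have "2 * \<bar>n * a\<bar> \<le> 1 + (n * a)\<^sup>2"
        using sum_squares_bound[of 1 "\<bar>n * a\<bar>"] by simp
      then have "2 * \<bar>n * a\<bar> / (2 * ?r) \<le> (1 + (n * a)\<^sup>2) / (2 * ?r)"
        using r by (intro divide_right_mono) auto
      moreover have "2 * \<bar>n * a\<bar> / (2 * ?r) = \<bar>?r * \<mu> * S / ?N\<bar>"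
      proof -
        have "2 * \<bar>n * a\<bar> / (2 * ?r) = n / ?r * \<bar>a\<bar>" by (simp add: abs_mult)
        also have "n / ?r = ?r" using r by (simp add: field_simps)
        also have "?r * \<bar>a\<bar> = \<bar>?r * a\<bar>" using r by (simp add: abs_mult)
        finally show ?thesis by (simp add: a_def mult.assoc)
      qed
      moreover have "(n * a)\<^sup>2 / (2 * ?r) = ?r * n * \<mu>\<^sup>2 / (2 * ?N\<^sup>2) * S\<^sup>2"
      proof -
        have "(n * a)\<^sup>2 / (2 * ?r) = real n ^ 2 / ?r * (a\<^sup>2 / 2)" by (simp add: power_mult_distrib)
        also have "real n ^ 2 / ?r = ?r * n" using r by (simp add: field_simps power2_eq_square)
        finally show ?thesis by (simp only: a_def power_mult_distrib power_divide) simp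
      qed
      ultimately show ?thesis by (simp add: add_divide_distrib)
    qed
    have b2: "\<bar>2 * (B * C) / (n * ?r)\<bar> \<le> ((B)\<^sup>2 + (C)\<^sup>2) / (n * ?r)"
    proof -
      have "\<bar>2 * (B * C)\<bar> \<le> (B)\<^sup>2 + (C)\<^sup>2"
        using sum_squares_bound[of "\<bar>B\<bar>" "\<bar>C\<bar>"] by (simp add: abs_mult)
      then have "\<bar>2 * (B * C)\<bar> / (n * ?r) \<le> ((B)\<^sup>2 + (C)\<^sup>2) / (n * ?r)"
        using r by (intro divide_right_mono) auto
      then show ?thesis using r by (simp add: abs_mult)
    qed
    have "\<epsilon> * \<mu>\<^sup>2 / 2 = \<mu> * (\<mu> / 2) * \<epsilon>" by (simp add: power2_eq_square)
    also have "\<dots> \<le> \<mu> * ?m * \<bar>T\<bar>"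
      using m \<mu> \<epsilon> large unfolding T_def by (intro mult_mono) auto
    also have "\<dots> = \<bar>\<mu> * ?m * T\<bar>" using m \<mu> by (simp add: abs_mult)
    also have "\<dots> \<le> R" unfolding T R_def using b1 b2 by linarith
    finally have "1 \<le> 2 / (\<epsilon> * \<mu>\<^sup>2) * R" using \<epsilon> \<mu> by (simp add: field_simps)
    then show ?thesis by (simp add: add_increasing2)
  qed
  then show ?thesis unfolding R_def .
qed

text \<open>
  The first limit law, freed from the reference distribution: \<open>\<delta>\<^sub>G\<close> for a known \<open>G\<close> cancels from the
  difference of the estimator and the parameter.
\<close>

theorem (in prob_space) delta_hat_asymptotically_normal:
  fixes X :: "nat \<Rightarrow> 'a \<Rightarrow> real" and F :: "real \<Rightarrow> real"
  assumes ind: "indep_vars (\<lambda>_. borel) X {1..}"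
    and nonneg: "\<And>i. 1 \<le> i \<Longrightarrow> AE \<omega> in M. 0 \<le> X i \<omega>"
    and cdf: "\<And>i. 1 \<le> i \<Longrightarrow> cdf (distr M borel (X i)) = F"
    and dens: "has_density F" and mean: "finite_pos_mean F"
    and sq: "integrable M (\<lambda>\<omega>. (max (X 1 \<omega>) (X 2 \<omega>) - delta_df F / 2 * (X 1 \<omega> + X 2 \<omega>))\<^sup>2)"
  shows "weak_conv_m (\<lambda>n. distr M borel (\<lambda>\<omega>. sqrt (real n) * (delta_hat n (\<lambda>i. X i \<omega>) - delta_df F)))
    (normal_law 0 (asym_var F))"
proof -
  define P where "P = interval_measure F"
  define \<mu> where "\<mu> = mean_df F"
  define d where "d = delta_df F / 2"
  have X: "X i \<in> borel_measurable M" if "1 \<le> i" for i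
    using ind that by (auto simp: indep_vars_def)
  have law: "distr M borel (X i) = P" if "1 \<le> i" for i
    using interval_measure_cdf[OF real_distribution_distr[OF X[OF that]]] cdf[OF that]
    by (simp add: P_def)
  have PF: "cdf P = F" using cdf[of 1] law[of 1] by simp
  have "real_distribution P" using real_distribution_distr[OF X[of 1]] law[of 1] by simp
  then interpret P: real_distribution P .
  interpret PP: pair_prob_space P P ..

  have int: "integrable P (\<lambda>t. t)" and \<mu>: "0 < \<mu>" and \<mu>_eq: "(\<integral>t. t \<partial>P) = \<mu>"
    using mean by (auto simp: finite_pos_mean_def P_def \<mu>_def mean_df_def)
  have atomless: "measure P {x} = 0" for x
    using has_density_no_atoms[OF dens, of x] by (simp add: P_def measure_def)
  have P_nonneg: "AE t in P. 0 \<le> t"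
    unfolding law[of 1, symmetric, simplified] using nonneg[of 1] X[of 1] by (subst AE_distr_iff) auto
  have "AE t in P. t \<noteq> 0"
  proof -
    have "{0} \<in> null_sets P" using has_density_no_atoms[OF dens, of 0] by (auto simp: P_def null_sets_def)
    then show ?thesis by (auto dest: AE_not_in)
  qed
  with P_nonneg have P_pos: "AE t in P. 0 < t" by eventually_elim simp

  have maxmean: "(\<integral>z. max (fst z) (snd z) \<partial>(P \<Otimes>\<^sub>M P)) = 2 * d * \<mu>"
    using \<mu> by (simp add: d_def delta_df_def mean_max_df_def P_def \<mu>_def)
  \<comment> \<open>Almost sure positivity makes the inequality strict; the second moment of the law depends on it.\<close>
  have d1: "d < 1"
    using P.mean_max_less_twice_mean[OF int P_pos] \<mu> unfolding maxmean \<mu>_eq by simp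
  have d0: "0 \<le> d"
  proof -
    note i = P.integrable_pair_fst_snd[OF int]
    have "\<mu> = (\<integral>z. fst z \<partial>(P \<Otimes>\<^sub>M P))" using i(3) \<mu>_eq by simp
    also have "\<dots> \<le> (\<integral>z. max (fst z) (snd z) \<partial>(P \<Otimes>\<^sub>M P))"
      using i by (intro integral_mono) auto
    finally have "0 \<le> 2 * d * \<mu>" using \<mu> unfolding maxmean by simp
    then show ?thesis using \<mu> by (simp add: zero_le_mult_iff)
  qed
  have sqPP: "integrable (P \<Otimes>\<^sub>M P) (\<lambda>z. (max (fst z) (snd z) - d * (fst z + snd z))\<^sup>2)"
  proof -
    have "P \<Otimes>\<^sub>M P = distr M (borel \<Otimes>\<^sub>M borel) (\<lambda>\<omega>. (X 1 \<omega>, X 2 \<omega>))"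
      by (rule joint_law_pair[OF ind, symmetric]) (use law in auto)
    then show ?thesis using sq X[of 1] X[of 2] by (simp add: integrable_distr_eq d_def)
  qed
  have sqP: "integrable P (\<lambda>t. t\<^sup>2)"
    by (rule P.square_integrable_from_kernel[OF P_nonneg d0 d1 sqPP])

  define k where "k x = (\<integral>t. max x t \<partial>P) - d * x" for x
  define h where "h x = k x - d * \<mu>" for x
  have k_meas [measurable]: "k \<in> borel_measurable borel" unfolding k_def by measurable
  have h_meas [measurable]: "h \<in> borel_measurable borel" unfolding h_def by measurable
  have int_max: "integrable P (\<lambda>x. \<integral>t. max x t \<partial>P)"
    and mean_max: "(\<integral>x. (\<integral>t. max x t \<partial>P) \<partial>P) = 2 * d * \<mu>"
  proof -
    have *: "integrable (P \<Otimes>\<^sub>M P) (\<lambda>z. max (fst z) (snd z))"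
      using P.integrable_pair_fst_snd[OF int] by simp
    show "integrable P (\<lambda>x. \<integral>t. max x t \<partial>P)" using PP.integrable_fst'[OF *] by simp
    show "(\<integral>x. (\<integral>t. max x t \<partial>P) \<partial>P) = 2 * d * \<mu>"
      using PP.integral_fst'[OF *] maxmean by simp
  qed
  have int_k: "integrable P k" and mean_k: "(\<integral>x. k x \<partial>P) = d * \<mu>"
    unfolding k_def using int int_max by (simp_all add: mean_max \<mu>_eq)
  have int_h: "integrable P h" and mean_h: "(\<integral>x. h x \<partial>P) = 0"
    unfolding h_def using int_k mean_k P.prob_space by simp_all
  have sq_h: "integrable P (\<lambda>x. (h x)\<^sup>2)"
  proof -
    define K where "K = (\<integral>t. \<bar>t\<bar> \<partial>P) + d * \<mu>"
    have K: "0 \<le> K" using d0 \<mu> by (simp add: K_def integral_nonneg_AE)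
    have "integrable P (\<lambda>x. ((1 + d) * \<bar>x\<bar> + K)\<^sup>2)"
      using sqP by (intro integrable_square_add) (auto simp: power_mult_distrib)
    then show ?thesis
    proof (rule Bochner_Integration.integrable_bound)
      have "(h x)\<^sup>2 \<le> ((1 + d) * \<bar>x\<bar> + K)\<^sup>2" for x
      proof (rule abs_le_square_iff[THEN iffD1])
        have "\<bar>h x\<bar> \<le> \<bar>\<integral>t. max x t \<partial>P\<bar> + \<bar>d * x\<bar> + \<bar>d * \<mu>\<bar>" unfolding h_def k_def by linarith
        also have "\<dots> \<le> (1 + d) * \<bar>x\<bar> + K"
          using P.abs_integral_max_le[OF int, of x] d0 \<mu> by (simp add: abs_mult K_def algebra_simps)
        finally show "\<bar>h x\<bar> \<le> \<bar>(1 + d) * \<bar>x\<bar> + K\<bar>" by simp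
      qed
      then show "AE x in P. norm ((h x)\<^sup>2) \<le> norm (((1 + d) * \<bar>x\<bar> + K)\<^sup>2)" by simp
    qed simp
  qed

  define \<sigma> where "\<sigma> = sqrt (\<integral>x. (h x)\<^sup>2 \<partial>P)"
  have \<sigma>2: "(\<integral>x. (h x)\<^sup>2 \<partial>P) = \<sigma>\<^sup>2" by (simp add: \<sigma>_def)
  have \<sigma>: "0 < \<sigma>"
  proof -
    have "(\<integral>x. (h x)\<^sup>2 \<partial>P) \<noteq> 0"
    proof
      assume "(\<integral>x. (h x)\<^sup>2 \<partial>P) = 0"
      then have "AE x in P. (h x)\<^sup>2 = 0"
        by (subst (asm) integral_nonneg_eq_0_iff_AE[OF sq_h]) auto
      then have "AE x in P. (\<integral>t. max x t \<partial>P) - d * x = d * \<mu>"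
        by eventually_elim (simp add: h_def k_def)
      then show False using P.integral_max_not_affine[OF int atomless] by blast
    qed
    then show ?thesis unfolding \<sigma>_def by (simp add: less_le)
  qed
  have var: "asym_var F = (2 / \<mu> * \<sigma>)\<^sup>2"
  proof -
    have "asym_var F = 4 / \<mu>\<^sup>2 * (\<integral>x. (k x - (\<integral>x. k x \<partial>P))\<^sup>2 \<partial>P)"
      using asym_var_eq[of F] P.real_distribution_axioms PF int
      by (simp add: P_def k_def d_def \<mu>_def)
    also have "(\<integral>x. (k x - (\<integral>x. k x \<partial>P))\<^sup>2 \<partial>P) = \<sigma>\<^sup>2"
      unfolding mean_k \<sigma>2[symmetric] h_def ..
    finally show ?thesis by (simp add: power_mult_distrib power_divide)
  qed

  define g where "g x y = max x y - d * (x + y) - h x - h y" for x y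
  define S where "S n \<omega> = (\<Sum>i=1..n. \<Sum>j\<in>{1..n}-{i}. g (X i \<omega>) (X j \<omega>))" for n \<omega>
  define B where "B n \<omega> = (\<Sum>i=1..n. h (X i \<omega>))" for n \<omega>
  define C where "C n \<omega> = (\<Sum>i=1..n. X i \<omega> - \<mu>)" for n \<omega>
  define c where "c = (\<integral>z. (g (fst z) (snd z))\<^sup>2 \<partial>(P \<Otimes>\<^sub>M P))"
  define v where "v = (\<integral>x. (x - \<mu>)\<^sup>2 \<partial>P)"
  have g_meas: "case_prod g \<in> borel_measurable (borel \<Otimes>\<^sub>M borel)"
    unfolding g_def case_prod_beta by measurable
  have g_deg: "(\<integral>x. g x y \<partial>P) = 0" for y
  proof -
    have "(\<integral>x. g x y \<partial>P) = (\<integral>x. max y x \<partial>P) - d * (\<mu> + y) - h y"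
      unfolding g_def using int int_h mean_h P.prob_space
      by (simp add: max.commute[of _ y] \<mu>_eq)
    then show ?thesis by (simp add: h_def k_def algebra_simps)
  qed
  have g_sq: "integrable (P \<Otimes>\<^sub>M P) (\<lambda>z. (g (fst z) (snd z))\<^sup>2)"
  proof -
    have "integrable (P \<Otimes>\<^sub>M P) (\<lambda>z. ((max (fst z) (snd z) - d * (fst z + snd z)) + - h (fst z) + - h (snd z))\<^sup>2)"
      using sqPP P.integrable_pair_fst_snd[OF sq_h] by (intro integrable_square_add) auto
    then show ?thesis by (simp add: g_def)
  qed
  have S2: "integrable M (\<lambda>\<omega>. (S n \<omega>)\<^sup>2)"
      "expectation (\<lambda>\<omega>. (S n \<omega>)\<^sup>2) = 2 * real n * (real n - 1) * c" for n
    unfolding S_def c_def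
    by (rule degenerate_U_statistic_second_moment[OF ind law g_meas _ g_deg g_sq];
        simp add: g_def max.commute add.commute)+
  have B2: "integrable M (\<lambda>\<omega>. (B n \<omega>)\<^sup>2)" "expectation (\<lambda>\<omega>. (B n \<omega>)\<^sup>2) = n * \<sigma>\<^sup>2" for n
    unfolding B_def \<sigma>2[symmetric]
    by (rule centered_sum_second_moment[OF ind law h_meas mean_h sq_h]; simp)+
  have C2: "integrable M (\<lambda>\<omega>. (C n \<omega>)\<^sup>2)" "expectation (\<lambda>\<omega>. (C n \<omega>)\<^sup>2) = n * v" for n
  proof -
    have 1: "(\<lambda>x. x - \<mu>) \<in> borel_measurable borel" by simp
    have 2: "(\<integral>x. x - \<mu> \<partial>P) = 0" using int \<mu>_eq P.prob_space by simp
    have 3: "integrable P (\<lambda>x. (x - \<mu>)\<^sup>2)"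
      using integrable_square_add[of "\<lambda>x. x" P "\<lambda>_. - \<mu>"] sqP by simp
    show "integrable M (\<lambda>\<omega>. (C n \<omega>)\<^sup>2)" "expectation (\<lambda>\<omega>. (C n \<omega>)\<^sup>2) = n * v"
      unfolding C_def v_def by (rule centered_sum_second_moment[OF ind law 1 2 3]; simp)+
  qed

  define T where "T n \<omega> = sqrt (real n) * (delta_hat n (\<lambda>i. X i \<omega>) - 2 * d)" for n \<omega>
  \<comment> \<open>The linear part of the error \<open>T n\<close>, to which the central limit theorem applies.\<close>
  define W where "W n \<omega> = 2 / \<mu> / sqrt (real n) * B n \<omega>" for n \<omega>
  have B_meas [measurable]: "B n \<in> borel_measurable M" for n
    unfolding B_def by (rule borel_measurable_sum) (use X in measurable)
  have W_meas [measurable]: "W n \<in> borel_measurable M" for n unfolding W_def by measurable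
  have sums_meas: "(\<lambda>\<omega>. \<Sum>i=1..n. \<Sum>j\<in>{1..n}-{i}. max (X i \<omega>) (X j \<omega>)) \<in> borel_measurable M"
    "(\<lambda>\<omega>. \<Sum>i=1..n. X i \<omega>) \<in> borel_measurable M" for n
    using X by (auto intro!: borel_measurable_sum borel_measurable_max)
  have T_meas [measurable]: "T n \<in> borel_measurable M" for n
    unfolding T_def delta_hat_def sample_mean_def using sums_meas[of n] by measurable

  have "weak_conv_m (\<lambda>n. distr M borel (T n)) (normal_law 0 (asym_var F))"
  proof (rule weak_conv_m_of_difference_to_zero[where X = W])
    show "real_distribution (normal_law 0 (asym_var F))"
      unfolding real_distribution_def real_distribution_axioms_def normal_law_def
      using \<sigma> \<mu> by (auto simp: var intro!: prob_space_normal_density)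
    show "weak_conv_m (\<lambda>n. distr M borel (W n)) (normal_law 0 (asym_var F))"
      unfolding W_def[abs_def] B_def var
      using \<mu> by (intro centered_sum_clt[OF ind law h_meas mean_h sq_h \<sigma> \<sigma>2]) auto
    fix \<epsilon> :: real assume \<epsilon>: "0 < \<epsilon>"
    define Q where "Q n \<omega> = 2 / (\<epsilon> * \<mu>\<^sup>2) * (1 / (2 * sqrt n)
        + sqrt n * n * \<mu>\<^sup>2 / (2 * (real n * (real n - 1))\<^sup>2) * (S n \<omega>)\<^sup>2
        + ((B n \<omega>)\<^sup>2 + (C n \<omega>)\<^sup>2) / (n * sqrt n)) + 4 / (n\<^sup>2 * \<mu>\<^sup>2) * (C n \<omega>)\<^sup>2" for n :: nat and \<omega>
    \<comment> \<open>Bounds \<open>sqrt n * expectation (Q n)\<close> for \<open>n \<ge> 2\<close>, by \<open>n - 1 \<ge> n / 2\<close> and \<open>sqrt n \<le> n\<close>.\<close>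
    define K where "K = 2 / (\<epsilon> * \<mu>\<^sup>2) * (1 / 2 + 2 * \<mu>\<^sup>2 * c + \<sigma>\<^sup>2 + v) + 4 * v / \<mu>\<^sup>2"
    have Q_int: "integrable M (Q n)" for n
      unfolding Q_def using S2 B2 C2 by simp
    have c0: "0 \<le> c" and v0: "0 \<le> v" by (auto simp: c_def v_def)
    have bound: "prob {\<omega> \<in> space M. \<epsilon> < \<bar>T n \<omega> - W n \<omega>\<bar>} \<le> K / sqrt n" if n: "2 \<le> n" for n
    proof -
      let ?A = "{\<omega> \<in> space M. \<epsilon> < \<bar>T n \<omega> - W n \<omega>\<bar>}"
      have r: "0 < sqrt (real n)" "sqrt (real n) * sqrt (real n) = n" "1 \<le> sqrt (real n)" using n by auto
      have "prob ?A = expectation (indicator ?A)" by simp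
      also have "\<dots> \<le> expectation (Q n)"
      proof (rule integral_mono)
        show "integrable M (indicator ?A :: 'a \<Rightarrow> real)" by (simp add: emeasure_eq_measure)
        show "integrable M (Q n)" by (rule Q_int)
        fix \<omega>
        show "indicator ?A \<omega> \<le> Q n \<omega>"
        proof (cases "\<omega> \<in> ?A")
          case True
          then have "\<epsilon> < \<bar>T n \<omega> - W n \<omega>\<bar>" by simp
          then have "1 \<le> Q n \<omega>"
            unfolding Q_def S_def B_def C_def g_def T_def W_def
            by (rule delta_hat_linearization_bound[OF n \<mu> \<epsilon>])
          then show ?thesis using True by simp
        next
          case False
          have "0 \<le> Q n \<omega>" unfolding Q_def using \<epsilon> by simp
          then show ?thesis using False by simp
        qed
      qed
      also have "expectation (Q n) = 2 / (\<epsilon> * \<mu>\<^sup>2) * (1 / (2 * sqrt n)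
          + sqrt n * n * \<mu>\<^sup>2 / (2 * (real n * (real n - 1))\<^sup>2) * (2 * real n * (real n - 1) * c)
          + (n * \<sigma>\<^sup>2 + n * v) / (n * sqrt n)) + 4 / (n\<^sup>2 * \<mu>\<^sup>2) * (n * v)"
        unfolding Q_def using S2 B2 C2 prob_space by simp
      also have "\<dots> \<le> 2 / (\<epsilon> * \<mu>\<^sup>2) * (1 / 2 / sqrt n + 2 * \<mu>\<^sup>2 * c / sqrt n + (\<sigma>\<^sup>2 + v) / sqrt n)
          + 4 * v / \<mu>\<^sup>2 / sqrt n"
      proof (intro add_mono mult_left_mono)
        show "sqrt n * n * \<mu>\<^sup>2 / (2 * (real n * (real n - 1))\<^sup>2) * (2 * real n * (real n - 1) * c) \<le> 2 * \<mu>\<^sup>2 * c / sqrt n"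
        proof -
          have "sqrt n * n * \<mu>\<^sup>2 / (2 * (real n * (real n - 1))\<^sup>2) * (2 * real n * (real n - 1) * c)
              = \<mu>\<^sup>2 * c * (sqrt n / (real n - 1))"
          proof -
            have "sqrt n * k * \<mu>\<^sup>2 / (2 * (k * l)\<^sup>2) * (2 * k * l * c) = \<mu>\<^sup>2 * c * (sqrt n / l)"
              if "0 < k" "0 < l" for k l :: real
              using that by (simp add: field_simps power2_eq_square)
            then show ?thesis using n by simp
          qed
          also have "sqrt n / (real n - 1) \<le> 2 / sqrt n"
            using n r by (simp add: field_simps)
          then have "\<mu>\<^sup>2 * c * (sqrt n / (real n - 1)) \<le> \<mu>\<^sup>2 * c * (2 / sqrt n)"
            using c0 by (intro mult_left_mono) auto
          finally show ?thesis by (simp add: mult_ac)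
        qed
        show "(n * \<sigma>\<^sup>2 + n * v) / (n * sqrt n) \<le> (\<sigma>\<^sup>2 + v) / sqrt n"
          using n by (simp add: add_divide_distrib)
        show "4 / (n\<^sup>2 * \<mu>\<^sup>2) * (n * v) \<le> 4 * v / \<mu>\<^sup>2 / sqrt n"
        proof -
          have "4 / (n\<^sup>2 * \<mu>\<^sup>2) * (n * v) = 4 * v / \<mu>\<^sup>2 / n"
            using n by (simp add: power2_eq_square)
          also have "\<dots> \<le> 4 * v / \<mu>\<^sup>2 / sqrt n"
          proof (rule divide_left_mono)
            show "sqrt n \<le> real n" using mult_right_mono[OF r(3), of "sqrt n"] r by simp
          qed (use v0 r n in auto)
          finally show ?thesis .
        qed
      qed (use \<epsilon> in auto)
      also have "\<dots> = K / sqrt n"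
        unfolding K_def by (simp add: add_divide_distrib distrib_left mult.assoc)
      finally show ?thesis .
    qed
    show "(\<lambda>n. prob {\<omega> \<in> space M. \<epsilon> < \<bar>T n \<omega> - W n \<omega>\<bar>}) \<longlonglongrightarrow> 0"
    proof (rule tendsto_sandwich)
      show "eventually (\<lambda>n. 0 \<le> prob {\<omega> \<in> space M. \<epsilon> < \<bar>T n \<omega> - W n \<omega>\<bar>}) sequentially" by simp
      show "eventually (\<lambda>n. prob {\<omega> \<in> space M. \<epsilon> < \<bar>T n \<omega> - W n \<omega>\<bar>} \<le> K / sqrt n) sequentially"
        using bound by (auto simp: eventually_sequentially)
      have "filterlim (\<lambda>n. sqrt (real n)) at_top sequentially"
        by (rule filterlim_compose[OF sqrt_at_top filterlim_real_sequentially])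
      then show "(\<lambda>n. K / sqrt (real n)) \<longlonglongrightarrow> 0"
        by (intro tendsto_divide_0[OF tendsto_const] filterlim_at_top_imp_at_infinity)
    qed simp
  qed measurable
  then show ?thesis by (simp add: T_def[abs_def] d_def)
qed

theorem theorem2p1:
  fixes M :: "'a measure" and X :: "nat \<Rightarrow> 'a \<Rightarrow> real" and F G0 :: "real \<Rightarrow> real"
  assumes "nonneg_dist_fun G0" and "finite_pos_mean G0"
    and "prob_space M"
    and "prob_space.indep_vars M (\<lambda>_. borel) X {1..}"
    and "\<And>i. 1 \<le> i \<Longrightarrow> AE \<omega> in M. 0 \<le> X i \<omega>"
    and "\<And>i. 1 \<le> i \<Longrightarrow> cdf (distr M borel (X i)) = F"
    and "has_density F" and "finite_pos_mean F"
    and "integrable M (\<lambda>\<omega>. (max (X 1 \<omega>) (X 2 \<omega>) - delta_df F / 2 * (X 1 \<omega> + X 2 \<omega>))\<^sup>2)"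
  shows
    "weak_conv_m
       (\<lambda>n. distr M borel
              (\<lambda>\<omega>. sqrt (real n) * (delta_hat_diff G0 n (\<lambda>i. X i \<omega>) - delta_diff F G0)))
       (normal_law 0 (asym_var F))
     \<and> (F =\<^sub>* G0 \<longrightarrow>
          weak_conv_m
            (\<lambda>n. distr M borel (\<lambda>\<omega>. sqrt (real n) * delta_hat_diff G0 n (\<lambda>i. X i \<omega>)))
            (normal_law 0 (asym_var G0)))"
proof -
  interpret prob_space M by fact
  have X1: "X 1 \<in> borel_measurable M"
    using assms(4) by (auto simp: indep_vars_def)
  have nonneg: "nonneg_dist_fun F"
    unfolding nonneg_dist_fun_def
  proof (intro exI conjI)
    show "real_distribution (distr M borel (X 1))" using X1 by simp
    show "AE z in distr M borel (X 1). 0 \<le> z" using X1 assms(5)[of 1] by (subst AE_distr_iff) auto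
    show "cdf (distr M borel (X 1)) = F" using assms(6)[of 1] by simp
  qed
  have lim: "weak_conv_m
      (\<lambda>n. distr M borel (\<lambda>\<omega>. sqrt (real n) * (delta_hat n (\<lambda>i. X i \<omega>) - delta_df F)))
      (normal_law 0 (asym_var F))"
    by (rule delta_hat_asymptotically_normal[OF assms(4-9)])
  show ?thesis
  proof (intro conjI impI)
    show "weak_conv_m
       (\<lambda>n. distr M borel
              (\<lambda>\<omega>. sqrt (real n) * (delta_hat_diff G0 n (\<lambda>i. X i \<omega>) - delta_diff F G0)))
       (normal_law 0 (asym_var F))"
      using lim by (simp add: delta_hat_diff_def delta_diff_def)
    assume "F =\<^sub>* G0"
    from star_eq_imp_equal_functionals[OF nonneg assms(8,7,1,2) this] lim
    show "weak_conv_m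
            (\<lambda>n. distr M borel (\<lambda>\<omega>. sqrt (real n) * delta_hat_diff G0 n (\<lambda>i. X i \<omega>)))
            (normal_law 0 (asym_var G0))"
      by (simp add: delta_hat_diff_def)
  qed
qed

end
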